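(* Let $(T,d)$ be a separable ultrametric space with diameter $D\in(0,\infty)$ and finite entropy numbers, let $L$ be its associated projective limit, and let $Z(t)=\sum_{n=0}^\infty\varepsilon_n\,g_{\Pi_n(t)}$ be the associated ultrametric Gaussian process, with $\varepsilon_n=2^{-n}D$ (all defined in the context). (a) For some absolute constant $\gamma>0$, we have for all $0<\varepsilon\le D$, $$\mathbb{P}\Big\{\sup_{s,t\in L}|Z(s)-Z(t)|\le\varepsilon\Big\}\le e^{-\gamma N(T,2\varepsilon)} .$$ (b) Let $d_Z(s,t)=\|Z(s)-Z(t)\|_2$ on $T$ and $D_Z=\mathrm{diam}(T,d_Z)$. Let $\mathcal{P}_0\preceq\mathcal{P}_1\preceq\cdots$ be a sequence of finite measurable ordered partitions of $T$ ($\mathcal{P}_{n+1}$ being a refinement of $\mathcal{P}_n$) with $\max_{\pi\in\mathcal{P}_n}\max_{u,v\in\pi}d_Z(u,v)\le2^{-n}D_Z$ for all $n\ge0$; let $N_n=\#\{\mathcal{P}_n\}$, and for $t\in T$ let $\pi_n(t)$ be the element of $\mathcal{P}_n$ containing $t$. Assume that there is a probability measure $\mu$ on $T$ such that $$\lim_{n\to\infty}\sup_{t\in T}\sum_{m>n}2^{-m}\Big(\log\frac1{\mu(\pi_m(t))}\Big)^{1/2}=0 .$$ Let $v(m)>0$ with $\sum_{m=0}^\infty v(m)^{-1}<\infty$, and put $H(n)=\sup_{t\in T}\sum_{m>n}(2^{-m}D_Z)\big(\log\frac{v(m)}{\mu(\pi_m(t))}\big)^{1/2}$. Let $\sigma=2D/\sqrt3$.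 For $0<\varepsilon\sigma<H(0)$, let $n(\varepsilon)$ be such that $H(n(\varepsilon))\le\varepsilon\sigma$. Then, for some constant $C>0$ not depending on $\varepsilon$, $$\mathbb{P}\Big\{\sup_{t\in T}|Z(t)|\le2\varepsilon\sigma\Big\}\ge C\,e^{-N_{n(\varepsilon)}\log\frac1\varepsilon}.$$
   Context: A metric space $(T,d)$ is ultrametric if $d(s,t)\le\max(d(s,u),d(u,t))$ for all $s,t,u\in T$. $N(T,\varepsilon)$ is the minimal number of closed $d$-balls of radius $\varepsilon$ needed to cover $T$. Let $D=\mathrm{diam}(T,d)$, $\varepsilon_n=2^{-n}D$, and let $S_n$ be the (finite) set of centers of balls forming a minimal covering of $(T,d)$ by closed balls of radius $\varepsilon_n$, $n=0,1,\ldots$. Define $\theta_n:T\to S_n$ by $d(s,\theta_n(s))\le\varepsilon_n$ and $\Pi_{n,n-1}:S_n\to S_{n-1}$ by $d(t,\Pi_{n,n-1}(t))\le\varepsilon_{n-1}$ (these are well defined, since in an ultrametric space two balls of the same radius are disjoint or identical); put $\Pi_{n,n}=\mathrm{Id}$ and $\Pi_{n,k}=\Pi_{n,n-1}\circ\cdots\circ\Pi_{k+1,k}$ for $n>k$. Let $L=\varprojlim\big((S_n),(\Pi_{n,k})\big)\subset\prod_{k\ge0}S_k$ be the projective limit, and let $\Pi_k:L\to S_k$ be the restriction to $L$ of the $k$-th coordinate projection. The map $\ell:T\to L$, $\ell(t)=\{\theta_k(t),k\ge0\}$, embeds $T$ into $L$; points of $T$ are identified with their images, so for $t\in T$, $\Pi_n(t)=\theta_n(t)$.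 Let $\{g_s\}$ be independent standard Gaussian random variables indexed by the disjoint union of the sets $S_k$, $k\ge0$, and put $Z(t)=\sum_{n=0}^\infty\varepsilon_n g_{\Pi_n(t)}$ for $t\in L$ (in particular for $t\in T$). $\|\cdot\|_2$ is the $L^2(\mathbb{P})$-norm.
   Formalization: In (b), for ε>1, n(ε) is taken to be the least n with H(n)≤εσ, since arbitrary n(ε) can make the bound exceed 1; in (a), γ is uniform over all spaces carried by one fixed underlying set, which covers every separable space up to isometry. *)

theory Defs
  imports "HOL-Probability.Probability"
begin

section \<open>Ultrametric spaces and entropy numbers\<close>

definition ultrametric_space :: "'a set \<Rightarrow> ('a \<Rightarrow> 'a \<Rightarrow> real) \<Rightarrow> bool" where
  "ultrametric_space T d \<longleftrightarrow>
     Metric_space T d \<and> (\<forall>s\<in>T. \<forall>t\<in>T. \<forall>u\<in>T. d s t \<le> max (d s u) (d u t))"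

definition diam :: "'a set \<Rightarrow> ('a \<Rightarrow> 'a \<Rightarrow> real) \<Rightarrow> real" where
  "diam T d = (SUP (s, t)\<in>T \<times> T. d s t)"

text \<open>\<open>C\<close> is the set of centers of a finite covering of \<open>T\<close> by closed balls of radius \<open>r\<close>.\<close>

definition ball_cover :: "'a set \<Rightarrow> ('a \<Rightarrow> 'a \<Rightarrow> real) \<Rightarrow> real \<Rightarrow> 'a set \<Rightarrow> bool" where
  "ball_cover T d r C \<longleftrightarrow>
     finite C \<and> C \<subseteq> T \<and> T \<subseteq> (\<Union>c\<in>C. Metric_space.mcball T d c r)"

definition finite_entropy :: "'a set \<Rightarrow> ('a \<Rightarrow> 'a \<Rightarrow> real) \<Rightarrow> bool" where
  "finite_entropy T d \<longleftrightarrow> (\<forall>r>0. \<exists>C. ball_cover T d r C)"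

definition entropy_number :: "'a set \<Rightarrow> ('a \<Rightarrow> 'a \<Rightarrow> real) \<Rightarrow> real \<Rightarrow> nat" where
  "entropy_number T d r = (LEAST n. \<exists>C. ball_cover T d r C \<and> card C = n)"

definition borel_sets_on :: "'a set \<Rightarrow> ('a \<Rightarrow> 'a \<Rightarrow> real) \<Rightarrow> 'a set set" where
  "borel_sets_on T d = sigma_sets T {U. openin (Metric_space.mtopology T d) U}"


section \<open>The projective limit\<close>

definition radius :: "'a set \<Rightarrow> ('a \<Rightarrow> 'a \<Rightarrow> real) \<Rightarrow> nat \<Rightarrow> real" where
  "radius T d n = diam T d / 2 ^ n"

definition minimal_nets :: "'a set \<Rightarrow> ('a \<Rightarrow> 'a \<Rightarrow> real) \<Rightarrow> (nat \<Rightarrow> 'a set) \<Rightarrow> bool" where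
  "minimal_nets T d S \<longleftrightarrow>
     (\<forall>n. ball_cover T d (radius T d n) (S n) \<and>
          card (S n) = entropy_number T d (radius T d n))"

text \<open>The map \<open>center T d S n\<close> is \<open>\<theta>\<^sub>n\<close> on \<open>T\<close>; its restriction to \<open>S (Suc n)\<close> is the
  bonding map \<open>\<Pi>\<close> from level \<open>n + 1\<close> to level \<open>n\<close>, since both maps are determined by the same
  inequality. The description is unique because closed balls of equal radius in an ultrametric
  space are disjoint or identical and the covering is minimal.\<close>

definition center :: "'a set \<Rightarrow> ('a \<Rightarrow> 'a \<Rightarrow> real) \<Rightarrow> (nat \<Rightarrow> 'a set) \<Rightarrow> nat \<Rightarrow> 'a \<Rightarrow> 'a" where
  "center T d S n t = (THE s. s \<in> S n \<and> d t s \<le> radius T d n)"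

text \<open>\<open>bond T d S k j\<close> maps \<open>S (k + j)\<close> to \<open>S k\<close>, that is, it is \<open>\<Pi>\<close> with indices \<open>k + j\<close>
  and \<open>k\<close>; the one-step map leaving the highest level is applied first.\<close>

primrec bond :: "'a set \<Rightarrow> ('a \<Rightarrow> 'a \<Rightarrow> real) \<Rightarrow> (nat \<Rightarrow> 'a set) \<Rightarrow> nat \<Rightarrow> nat \<Rightarrow> 'a \<Rightarrow> 'a" where
  "bond T d S k 0 = id"
| "bond T d S k (Suc j) = bond T d S k j \<circ> center T d S (k + j)"

definition proj_limit :: "'a set \<Rightarrow> ('a \<Rightarrow> 'a \<Rightarrow> real) \<Rightarrow> (nat \<Rightarrow> 'a set) \<Rightarrow> (nat \<Rightarrow> 'a) set" where
  "proj_limit T d S =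
     {x. (\<forall>k. x k \<in> S k) \<and> (\<forall>n k. k \<le> n \<longrightarrow> bond T d S k (n - k) (x n) = x k)}"

definition limit_embed :: "'a set \<Rightarrow> ('a \<Rightarrow> 'a \<Rightarrow> real) \<Rightarrow> (nat \<Rightarrow> 'a set) \<Rightarrow> 'a \<Rightarrow> (nat \<Rightarrow> 'a)" where
  "limit_embed T d S t = (\<lambda>k. center T d S k t)"


section \<open>The ultrametric Gaussian process\<close>

text \<open>The disjoint union of the levels \<open>S k\<close> is \<open>Sigma UNIV S\<close>.\<close>

definition ultrametric_gaussian ::
  "'a set \<Rightarrow> ('a \<Rightarrow> 'a \<Rightarrow> real) \<Rightarrow> (nat \<Rightarrow> 'a set) \<Rightarrow> 'b measure \<Rightarrow> (nat \<times> 'a \<Rightarrow> 'b \<Rightarrow> real) \<Rightarrow> bool"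
where
  "ultrametric_gaussian T d S M g \<longleftrightarrow>
     ultrametric_space T d \<and> separable_space (Metric_space.mtopology T d) \<and>
     finite_entropy T d \<and> 0 < diam T d \<and> minimal_nets T d S \<and>
     prob_space M \<and>
     prob_space.indep_vars M (\<lambda>_. borel) g (Sigma UNIV S) \<and>
     (\<forall>i\<in>Sigma UNIV S. distributed M lborel (g i) (\<lambda>x. ennreal (std_normal_density x)))"

definition Z_term ::
  "'a set \<Rightarrow> ('a \<Rightarrow> 'a \<Rightarrow> real) \<Rightarrow> (nat \<times> 'a \<Rightarrow> 'b \<Rightarrow> real) \<Rightarrow> (nat \<Rightarrow> 'a) \<Rightarrow> 'b \<Rightarrow> nat \<Rightarrow> real"
where
  "Z_term T d g x \<omega> n = radius T d n * g (n, x n) \<omega>"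

definition Z ::
  "'a set \<Rightarrow> ('a \<Rightarrow> 'a \<Rightarrow> real) \<Rightarrow> (nat \<times> 'a \<Rightarrow> 'b \<Rightarrow> real) \<Rightarrow> (nat \<Rightarrow> 'a) \<Rightarrow> 'b \<Rightarrow> real"
where
  "Z T d g x \<omega> = (\<Sum>n. Z_term T d g x \<omega> n)"

definition Z_dist ::
  "'a set \<Rightarrow> ('a \<Rightarrow> 'a \<Rightarrow> real) \<Rightarrow> (nat \<Rightarrow> 'a set) \<Rightarrow> 'b measure \<Rightarrow> (nat \<times> 'a \<Rightarrow> 'b \<Rightarrow> real) \<Rightarrow>
     'a \<Rightarrow> 'a \<Rightarrow> real"
where
  "Z_dist T d S M g s t =
     sqrt (\<integral>\<omega>. (Z T d g (limit_embed T d S s) \<omega> - Z T d g (limit_embed T d S t) \<omega>)\<^sup>2 \<partial>M)"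

text \<open>For every fixed point the series \<open>Z\<close> converges almost surely, but the exceptional null set
  depends on the point, so over an uncountable index set divergence and measurability matter.
  Both events below are read so as to make the estimates about them strongest: the first one, whose
  outer measure is bounded above, only compares points at which the series converges; the second
  one, whose inner measure is bounded below, asks that it converge everywhere. Suprema are taken in
  the extended reals.\<close>

definition small_oscillation ::
  "'a set \<Rightarrow> ('a \<Rightarrow> 'a \<Rightarrow> real) \<Rightarrow> 'b measure \<Rightarrow> (nat \<times> 'a \<Rightarrow> 'b \<Rightarrow> real) \<Rightarrow>
     (nat \<Rightarrow> 'a) set \<Rightarrow> real \<Rightarrow> 'b set"
where
  "small_oscillation T d M g A r =
     {\<omega> \<in> space M.
        (let A' = {x \<in> A. summable (Z_term T d g x \<omega>)}
         in (SUP (x, y)\<in>A' \<times> A'. ereal \<bar>Z T d g x \<omega> - Z T d g y \<omega>\<bar>)) \<le> ereal r}"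

definition small_sup ::
  "'a set \<Rightarrow> ('a \<Rightarrow> 'a \<Rightarrow> real) \<Rightarrow> 'b measure \<Rightarrow> (nat \<times> 'a \<Rightarrow> 'b \<Rightarrow> real) \<Rightarrow>
     (nat \<Rightarrow> 'a) set \<Rightarrow> real \<Rightarrow> 'b set"
where
  "small_sup T d M g A r =
     {\<omega> \<in> space M. (\<forall>x\<in>A. summable (Z_term T d g x \<omega>)) \<and>
        (SUP x\<in>A. ereal \<bar>Z T d g x \<omega>\<bar>) \<le> ereal r}"

text \<open>Counterpart of \<^const>\<open>outer_measure_of\<close>; both agree with the measure on measurable sets.\<close>

definition inner_measure_of :: "'b measure \<Rightarrow> 'b set \<Rightarrow> ennreal" where
  "inner_measure_of M A = (SUP B\<in>{B \<in> sets M. B \<subseteq> A}. emeasure M B)"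


section \<open>Partitions and majorizing measures\<close>

definition cell :: "'a set set \<Rightarrow> 'a \<Rightarrow> 'a set" where
  "cell P t = (THE A. A \<in> P \<and> t \<in> A)"

definition admissible_partitions ::
  "'a set \<Rightarrow> ('a \<Rightarrow> 'a \<Rightarrow> real) \<Rightarrow> ('a \<Rightarrow> 'a \<Rightarrow> real) \<Rightarrow> (nat \<Rightarrow> 'a set set) \<Rightarrow> bool"
where
  "admissible_partitions T d dZ P \<longleftrightarrow>
     (\<forall>n. finite (P n) \<and> partition_on T (P n) \<and> P n \<subseteq> borel_sets_on T d \<and>
          refines T (P (Suc n)) (P n) \<and>
          (\<forall>A\<in>P n. \<forall>u\<in>A. \<forall>v\<in>A. dZ u v \<le> diam T dZ / 2 ^ n))"

text \<open>The square root of \<open>log (v / p)\<close>. It is \<open>\<infinity>\<close> for \<open>p = 0\<close>, and where the logarithm is negative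
  (\<open>v < p\<close>, possible for finitely many levels only) \<^const>\<open>ennreal\<close> truncates it to \<open>0\<close>.\<close>

definition sqrt_log :: "real \<Rightarrow> real \<Rightarrow> ennreal" where
  "sqrt_log v p = (if p = 0 then \<infinity> else ennreal (sqrt (ln (v / p))))"

text \<open>Supremum over \<open>t\<close> of the sum over \<open>m > n\<close> of \<open>c 2\<^sup>-\<^sup>m (log (v m / \<mu> (\<pi>\<^sub>m t)))\<^sup>1\<^sup>/\<^sup>2\<close>; the
  summation index is \<open>m = n + 1 + j\<close>.\<close>

definition log_tail ::
  "'a set \<Rightarrow> (nat \<Rightarrow> 'a set set) \<Rightarrow> 'a measure \<Rightarrow> real \<Rightarrow> (nat \<Rightarrow> real) \<Rightarrow> nat \<Rightarrow> ennreal"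
where
  "log_tail T P \<mu> c v n =
     (SUP t\<in>T. \<Sum>j. let m = n + 1 + j
        in ennreal (c / 2 ^ m) * sqrt_log (v m) (measure \<mu> (cell (P m) t)))"

text \<open>The condition on the index \<open>n = n(\<epsilon>)\<close>. For \<open>\<epsilon> \<le> 1\<close> any \<open>n\<close> with \<open>H n \<le> \<epsilon> \<sigma>\<close> is allowed. For
  \<open>\<epsilon> > 1\<close> (which can occur, as \<open>H 0\<close> may exceed \<open>\<sigma>\<close>) the bound \<open>exp (- N\<^sub>n log (1 / \<epsilon>))\<close>
  grows with \<open>n\<close> and would exceed every multiple of a probability for large \<open>n\<close>; there
  \<open>n\<close> is the least such index.\<close>

definition admissible_level :: "(nat \<Rightarrow> ennreal) \<Rightarrow> real \<Rightarrow> real \<Rightarrow> nat \<Rightarrow> bool" where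
  "admissible_level H \<sigma> \<epsilon> n \<longleftrightarrow>
     H n \<le> ennreal (\<epsilon> * \<sigma>) \<and> (\<epsilon> \<le> 1 \<or> (\<forall>k<n. ennreal (\<epsilon> * \<sigma>) < H k))"

end

theory Submission
  imports Defs
begin

text \<open>Upper bound: at a level \<open>n\<close> with \<open>\<epsilon> \<le> 2 \<epsilon>\<^sub>n\<close>, the values of \<open>Z\<close> at the points of \<open>S n\<close>
  contain independent summands \<open>\<epsilon>\<^sub>n g\<close>. Given all other variables, each of them
  has to fall into an interval of length \<open>4\<close> in units of the standard deviation, which costs a
  factor \<open>q < 1\<close> per point.

  Lower bound: \<open>d\<^sub>Z\<close> depends only on the first level at which two points separate, so a cell of
  \<open>P m\<close> has a single ancestor in \<open>S m\<close>. Above level \<open>n\<close> the thresholds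
  \<open>(2 log (v m / \<mu>))\<^sup>1\<^sup>/\<^sup>2\<close> hold simultaneously with probability at least \<open>1/2\<close> by the union bound,
  and their weighted sum is at most \<open>\<surd>3 H n \<le> 7/4 \<epsilon> \<sigma>\<close>. The remaining \<open>\<epsilon> \<sigma> / 4\<close> suffices for the
  partial sums up to level \<open>n\<close>: a constant factor per point is harmless because all but boundedly
  many points only contribute their deviation from a nearby representative, which is as small as we
  please. A pigeonhole argument on two independent copies of the Gaussian vector replaces
  the inequalities of Anderson and Sidak.\<close>

section \<open>Nets in ultrametric spaces\<close>

text \<open>The constant of the lower bound may not depend on \<open>n\<close>, so an extra factor
  \<open>c < 1\<close> per net point would be fatal. The box that controls the partial sums has
  probability at least \<open>(1/2) ^ card (S n)\<close>, and the pigeonhole squares it; the scale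
  of the fluctuations is therefore tuned so that each point earns the factor
  \<open>4 * \<epsilon>\<close> and the 4 cancels exactly. This needs small
  \<open>\<epsilon>\<close>. Larger values are compared with a fixed small one by monotonicity,
  where finiteness of \<open>H 0\<close> and the choice of the least level keep the claimed bound
  bounded.

  \<open>\<sigma>\<close> is the standard deviation of each value of the process, as the sum of the
  squared radii is 4/3 of the squared diameter. The diameter for the induced distance is
  \<open>\<sigma> / sqrt 2\<close>, and sqrt 3 is the ratio of \<open>sqrt 2 * radius T d m\<close>
  to that diameter divided by \<open>2 ^ m\<close>.

  Almost sure convergence at each point gives nothing simultaneous for uncountably many points. So
  the upper bound keeps only one finite net, and the lower bound works on a measurable event on
  which every point has a convergent majorant.\<close>

locale ultrametric_nets =
  fixes T :: "'a set" and d S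
  assumes ultrametric: "ultrametric_space T d"
    and diam_pos: "0 < diam T d"
    and nets: "minimal_nets T d S"
begin

sublocale metric: Metric_space T d
  using ultrametric by (simp add: ultrametric_space_def)

abbreviation "rad \<equiv> radius T d"
abbreviation "ctr \<equiv> center T d S"

lemma ultra: "s \<in> T \<Longrightarrow> t \<in> T \<Longrightarrow> u \<in> T \<Longrightarrow> d s t \<le> max (d s u) (d u t)"
  using ultrametric by (simp add: ultrametric_space_def)

lemma dist_le_trans: "s \<in> T \<Longrightarrow> t \<in> T \<Longrightarrow> u \<in> T \<Longrightarrow> d s u \<le> r \<Longrightarrow> d u t \<le> r \<Longrightarrow> d s t \<le> r"
  using ultra[of s t u] by linarith

lemma rad_pos: "0 < rad n" and rad_nonneg: "0 \<le> rad n"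
  using diam_pos by (simp_all add: radius_def)

lemma rad_antimono: "k \<le> n \<Longrightarrow> rad n \<le> rad k"
  using diam_pos by (simp add: radius_def divide_left_mono power_increasing)

lemma cover: "ball_cover T d (rad n) (S n)"
  and card_net: "card (S n) = entropy_number T d (rad n)"
  using nets by (auto simp: minimal_nets_def)

lemma finite_net: "finite (S n)" and net_subset: "u \<in> S n \<Longrightarrow> u \<in> T"
  using cover[of n] by (auto simp: ball_cover_def)

lemma entropy_number_le_card: "ball_cover T d r C \<Longrightarrow> entropy_number T d r \<le> card C"
  unfolding entropy_number_def by (rule Least_le) blast

text \<open>Minimality at work: if two centers were within the radius of each other, the ball around
  \<open>s'\<close> would lie in the ball around \<open>s\<close>, and the cover could do without
  \<open>s'\<close>.\<close>

lemma net_dist_le_iff: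
  assumes "s \<in> S n" "s' \<in> S n"
  shows "d s s' \<le> rad n \<longleftrightarrow> s = s'"
proof
  assume le: "d s s' \<le> rad n"
  show "s = s'"
  proof (rule ccontr)
    assume "s \<noteq> s'"
    have "T \<subseteq> (\<Union>c\<in>S n - {s'}. metric.mcball c (rad n))"
    proof
      fix t assume t: "t \<in> T"
      then obtain c where c: "c \<in> S n" "d c t \<le> rad n"
        using cover[of n] by (auto simp: ball_cover_def)
      show "t \<in> (\<Union>c\<in>S n - {s'}. metric.mcball c (rad n))"
      proof (cases "c = s'")
        case True
        with c t have "d s t \<le> rad n"
          using dist_le_trans[OF _ t _ le] assms net_subset by blast
        then show ?thesis using assms \<open>s \<noteq> s'\<close> t net_subset by auto
      qed (use c t net_subset in auto)
    qed
    then have "ball_cover T d (rad n) (S n - {s'})"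
      using cover[of n] by (auto simp: ball_cover_def)
    then show False
      using entropy_number_le_card card_net[of n] card_Diff1_less[OF finite_net assms(2)]
      by (metis not_le)
  qed
next
  show "s = s' \<Longrightarrow> d s s' \<le> rad n"
    using assms net_subset[of s n] rad_nonneg[of n] by simp
qed

text \<open>Resolves the definite description in \<open>center\<close>: two centers within the
  radius of \<open>t\<close> are within the radius of each other by the ultrametric inequality, so
  they coincide.\<close>

lemma center_eqI:
  assumes "t \<in> T" "s \<in> S n" "d t s \<le> rad n"
  shows "ctr n t = s"
  unfolding center_def
proof (rule the_equality)
  fix s' assume s': "s' \<in> S n \<and> d t s' \<le> rad n"
  then have "d s s' \<le> rad n"
    using dist_le_trans[of s s' t] assms net_subset metric.commute[of s t] by auto
  then show "s' = s" using net_dist_le_iff assms s' by blast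
qed (use assms in auto)

lemma center_in: "t \<in> T \<Longrightarrow> ctr n t \<in> S n"
  and dist_center: "t \<in> T \<Longrightarrow> d t (ctr n t) \<le> rad n"
proof -
  assume t: "t \<in> T"
  then obtain c where c: "c \<in> S n" "d c t \<le> rad n"
    using cover[of n] by (auto simp: ball_cover_def)
  then have "ctr n t = c" using center_eqI[of t c n] t metric.commute by simp
  then show "ctr n t \<in> S n" "d t (ctr n t) \<le> rad n"
    using c metric.commute by auto
qed

lemma center_in_T: "t \<in> T \<Longrightarrow> ctr n t \<in> T"
  using center_in net_subset by blast

lemma center_net: "u \<in> S n \<Longrightarrow> ctr n u = u"
  by (rule center_eqI) (use net_subset rad_nonneg in auto)

text \<open>Moving \<open>t\<close> to its center at a finer level keeps it inside the same ball of
  the coarser radius. This makes the bonding maps compatible with the maps from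
  \<open>T\<close>.\<close>

lemma center_center: "t \<in> T \<Longrightarrow> k \<le> n \<Longrightarrow> ctr k (ctr n t) = ctr k t"
proof (rule center_eqI)
  assume t: "t \<in> T" and kn: "k \<le> n"
  have "d (ctr n t) t \<le> rad k"
    using dist_center[OF t, of n] rad_antimono[OF kn] metric.commute[of "ctr n t" t] by linarith
  then show "d (ctr n t) (ctr k t) \<le> rad k"
    using dist_le_trans[of "ctr n t" "ctr k t" t] t center_in_T dist_center by blast
qed (auto simp: center_in center_in_T)

lemma center_eq_mono:
  "s \<in> T \<Longrightarrow> t \<in> T \<Longrightarrow> k \<le> n \<Longrightarrow> ctr n s = ctr n t \<Longrightarrow> ctr k s = ctr k t"
  by (metis center_center)

lemma center_center_ge: "u \<in> S k \<Longrightarrow> k \<le> n \<Longrightarrow> ctr k (ctr n u) = u"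
  using center_center[of u k n] center_net net_subset by simp

lemma bond_center: "t \<in> T \<Longrightarrow> bond T d S k j (ctr (k + j) t) = ctr k t"
proof (induction j)
  case (Suc j)
  then show ?case using center_center[of t "k + j" "Suc (k + j)"] by simp
qed simp

lemma limit_embed_in: "t \<in> T \<Longrightarrow> limit_embed T d S t \<in> proj_limit T d S"
  using bond_center[of t] by (auto simp: limit_embed_def proj_limit_def center_in)
    (metis le_add_diff_inverse)

text \<open>\<open>ctr k\<close> maps \<open>S n\<close> onto \<open>S k\<close>.\<close>

lemma card_net_mono: "k \<le> n \<Longrightarrow> card (S k) \<le> card (S n)"
proof -
  assume kn: "k \<le> n"
  have "S k \<subseteq> ctr k ` S n"
  proof
    fix u assume u: "u \<in> S k"
    then have "ctr n u \<in> S n" using center_in net_subset by blast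
    then show "u \<in> ctr k ` S n" using center_center_ge[OF u kn] by force
  qed
  then show ?thesis by (rule surj_card_le[OF finite_net])
qed

lemma entropy_number_le_card_net: "rad n \<le> r \<Longrightarrow> entropy_number T d r \<le> card (S n)"
  using cover[of n]
  by (intro entropy_number_le_card) (force simp: ball_cover_def)

text \<open>Points sharing a center at level \<open>n\<close> are pairwise within
  \<open>rad n\<close>, so a net with a single point would force the diameter below half of
  itself.\<close>

lemma card_net_ge_2:
  assumes "T \<noteq> {}" "1 \<le> n"
  shows "2 \<le> card (S n)"
proof (rule ccontr)
  assume "\<not> 2 \<le> card (S n)"
  then have "card (S n) \<le> 1" by simp
  then have eq: "x = y" if "x \<in> S n" "y \<in> S n" for x y
    using that finite_net card_le_Suc0_iff_eq by auto
  have "d s t \<le> rad n" if st: "s \<in> T" "t \<in> T" for s t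
  proof -
    have "ctr n s = ctr n t" using eq center_in st by blast
    then show ?thesis
      using dist_le_trans[of s t "ctr n s"] st dist_center center_in_T metric.commute by metis
  qed
  then have "diam T d \<le> rad n"
    unfolding diam_def using assms(1) by (intro cSUP_least) auto
  moreover have "rad n \<le> rad 1" using rad_antimono assms by blast
  moreover have "rad 1 < diam T d" using diam_pos by (simp add: radius_def)
  ultimately show False by linarith
qed

end

section \<open>Independent standard Gaussian variables\<close>

abbreviation std_normal :: "real measure" where
  "std_normal \<equiv> density lborel (\<lambda>x. ennreal (std_normal_density x))"

lemma prob_space_std_normal: "prob_space std_normal"
  by (rule prob_space_normal_density) simp

text \<open>Shift of the density: with \<open>b\<close> equal to \<open>a\<close> or
  \<open>- a\<close>, the inequality x^2 >= a^2 + (x - b)^2 holds on the corresponding half-line, so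
  the density there is at most \<open>exp (- a\<^sup>2 / 2)\<close> times the one with mean
  \<open>b\<close>, which integrates to 1.\<close>

lemma std_normal_tail:
  assumes "0 \<le> a"
  shows "measure std_normal {a<..} \<le> exp (- a\<^sup>2 / 2)"
    and "measure std_normal {..<-a} \<le> exp (- a\<^sup>2 / 2)"
proof -
  interpret N: prob_space std_normal by (rule prob_space_std_normal)
  have *: "measure std_normal A \<le> exp (- a\<^sup>2 / 2)"
    if A: "A \<in> sets borel" and le: "\<And>x. x \<in> A \<Longrightarrow> 2 * a\<^sup>2 \<le> 2 * b * x" and b: "b\<^sup>2 = a\<^sup>2" for A b
  proof -
    have pt: "std_normal_density x \<le> exp (- a\<^sup>2 / 2) * normal_density b 1 x" if "x \<in> A" for x
    proof -
      have "exp (- x\<^sup>2 / 2) \<le> exp (- a\<^sup>2 / 2 + - (x - b)\<^sup>2 / 2)"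
        using le[OF that] b by (auto simp: power2_diff field_simps)
      then have "exp (- x\<^sup>2 / 2) \<le> exp (- a\<^sup>2 / 2) * exp (- (x - b)\<^sup>2 / 2)"
        by (simp only: exp_add)
      then show ?thesis
        by (simp add: normal_density_def divide_right_mono)
    qed
    have "emeasure std_normal A = (\<integral>\<^sup>+x. ennreal (std_normal_density x) * indicator A x \<partial>lborel)"
      using A by (simp add: emeasure_density)
    also have "\<dots> \<le> (\<integral>\<^sup>+x. ennreal (exp (- a\<^sup>2 / 2)) * ennreal (normal_density b 1 x) \<partial>lborel)"
      using pt by (intro nn_integral_mono) (auto simp: indicator_def simp flip: ennreal_mult)
    also have "\<dots> = ennreal (exp (- a\<^sup>2 / 2)) * emeasure (density lborel (normal_density b 1)) UNIV"
      by (subst nn_integral_cmult) (auto simp: emeasure_density)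
    also have "\<dots> = ennreal (exp (- a\<^sup>2 / 2))"
      using prob_space.emeasure_space_1[OF prob_space_normal_density[of 1 b]] by simp
    finally show ?thesis
      by (simp add: N.emeasure_eq_measure)
  qed
  show "measure std_normal {a<..} \<le> exp (- a\<^sup>2 / 2)"
    using assms by (intro *[of _ a]) (auto simp: power2_eq_square mult_left_mono)
  show "measure std_normal {..<-a} \<le> exp (- a\<^sup>2 / 2)"
  proof (rule *[of _ "-a"])
    show "2 * a\<^sup>2 \<le> 2 * - a * x" if "x \<in> {..<-a}" for x
      using that assms mult_left_mono[of a "-x" a] by (simp add: power2_eq_square)
  qed auto
qed

lemma std_normal_pos:
  assumes "A \<in> sets borel" "emeasure lborel A \<noteq> 0"
  shows "0 < measure std_normal A"
proof -
  interpret N: prob_space std_normal by (rule prob_space_std_normal)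
  have "emeasure std_normal A \<noteq> 0"
  proof
    assume "emeasure std_normal A = 0"
    then have "A \<in> null_sets std_normal" using assms by auto
    then have "AE x in lborel. x \<in> A \<longrightarrow> ennreal (std_normal_density x) = 0"
      using assms by (subst (asm) null_sets_density_iff) auto
    then have "AE x in lborel. x \<notin> A" by (simp add: normal_density_def)
    then show False using assms AE_iff_null_sets[of A lborel] by (auto dest: null_setsD1)
  qed
  then show ?thesis
    by (simp add: N.emeasure_eq_measure zero_less_measure_iff)
qed

text \<open>An interval of length 4 misses \<open>{-3<..<-2}\<close> if its midpoint is nonnegative
  and \<open>{2<..<3}\<close> otherwise.\<close>

lemma std_normal_interval_bound:
  obtains q where "0 < q" "q < 1" "\<And>c. measure std_normal {c - 2..c + 2} \<le> q"
proof -
  interpret N: prob_space std_normal by (rule prob_space_std_normal)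
  have pos: "0 < measure std_normal {2<..<3}" "0 < measure std_normal {-3<..<-2}"
    by (auto intro!: std_normal_pos)
  \<comment> \<open>The 1/2 makes positivity of \<open>q\<close> immediate; \<open>ln q\<close> is
    taken later.\<close>
  define q where "q = max (1/2) (max (1 - measure std_normal {2<..<3}) (1 - measure std_normal {-3<..<-2}))"
  have le: "measure std_normal A \<le> 1 - measure std_normal B"
    if "A \<inter> B = {}" "A \<in> sets borel" "B \<in> sets borel" for A B
    using N.finite_measure_Union[of A B] that N.prob_le_1[of "A \<union> B"] by simp
  show ?thesis
  proof
    show "0 < q" "q < 1" using pos by (auto simp: q_def)
    show "measure std_normal {c - 2..c + 2} \<le> q" for c
    proof (cases "0 \<le> c")
      case True
      then have "measure std_normal {c - 2..c + 2} \<le> 1 - measure std_normal {-3<..<-2}"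
        by (intro le) auto
      then show ?thesis by (simp add: q_def)
    next
      case False
      then have "measure std_normal {c - 2..c + 2} \<le> 1 - measure std_normal {2<..<3}"
        by (intro le) auto
      then show ?thesis by (simp add: q_def)
    qed
  qed
qed

section \<open>Families of independent standard normal variables\<close>

locale std_normal_family = prob_space M for M :: "'b measure" +
  fixes X :: "'i \<Rightarrow> 'b \<Rightarrow> real" and I :: "'i set"
  assumes indep: "indep_vars (\<lambda>_. borel) X I"
    and normal: "\<And>i. i \<in> I \<Longrightarrow> distributed M lborel (X i) (\<lambda>x. ennreal (std_normal_density x))"
begin

lemma measurable_X: "i \<in> I \<Longrightarrow> X i \<in> borel_measurable M"
  using indep by (auto simp: indep_vars_def2)

lemma measurable_restrict_X:
  "J \<subseteq> I \<Longrightarrow> (\<lambda>\<omega>. \<lambda>i\<in>J. X i \<omega>) \<in> M \<rightarrow>\<^sub>M PiM J (\<lambda>_. borel)"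
  using measurable_X by (intro measurable_restrict) auto

lemma distr_X: "i \<in> I \<Longrightarrow> distr M borel (X i) = std_normal"
  using distributed_distr_eq_density[OF normal] by (simp cong: distr_cong)

lemma law:
  assumes "J \<subseteq> I" "J \<noteq> {}"
  shows "distr M (PiM J (\<lambda>_. borel)) (\<lambda>\<omega>. \<lambda>i\<in>J. X i \<omega>) = PiM J (\<lambda>_. std_normal)"
proof -
  have "distr M (PiM J (\<lambda>_. borel)) (\<lambda>\<omega>. \<lambda>i\<in>J. X i \<omega>) = PiM J (\<lambda>i. distr M borel (X i))"
    using indep_vars_subset[OF indep assms(1)] assms measurable_X
    by (subst (asm) indep_vars_iff_distr_eq_PiM') auto
  also have "\<dots> = PiM J (\<lambda>_. std_normal)"
    using assms by (intro PiM_cong) (auto simp: distr_X)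
  finally show ?thesis .
qed

text \<open>Moves the computation to the canonical product space. The pigeonhole argument needs room
  for a second independent copy, which \<open>M\<close> itself need not provide.\<close>

lemma prob_restrict:
  assumes "J \<subseteq> I" "J \<noteq> {}" "E \<in> sets (PiM J (\<lambda>_. borel))"
  shows "prob {\<omega> \<in> space M. (\<lambda>i\<in>J. X i \<omega>) \<in> E} = measure (PiM J (\<lambda>_. std_normal)) E"
proof -
  have "measure (distr M (PiM J (\<lambda>_. borel)) (\<lambda>\<omega>. \<lambda>i\<in>J. X i \<omega>)) E
      = prob ((\<lambda>\<omega>. \<lambda>i\<in>J. X i \<omega>) -` E \<inter> space M)"
    using assms by (intro measure_distr measurable_restrict_X) auto
  also have "(\<lambda>\<omega>. \<lambda>i\<in>J. X i \<omega>) -` E \<inter> space M = {\<omega> \<in> space M. (\<lambda>i\<in>J. X i \<omega>) \<in> E}"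
    by auto
  finally show ?thesis by (simp only: law[OF assms(1,2)])
qed

lemma prob_tail:
  assumes "i \<in> I" "0 \<le> a"
  shows "prob {\<omega> \<in> space M. a < \<bar>X i \<omega>\<bar>} \<le> 2 * exp (- a\<^sup>2 / 2)"
proof -
  interpret N: prob_space std_normal by (rule prob_space_std_normal)
  have "prob {\<omega> \<in> space M. a < \<bar>X i \<omega>\<bar>} = measure (distr M borel (X i)) {x. a < \<bar>x\<bar>}"
    using assms(1) measurable_X by (subst measure_distr) (auto intro!: arg_cong[where f = prob])
  also have "\<dots> = measure std_normal ({a<..} \<union> {..<-a})"
    using assms by (simp add: distr_X) (rule arg_cong[where f = "measure std_normal"], auto)
  also have "\<dots> \<le> measure std_normal {a<..} + measure std_normal {..<-a}"
    by (rule measure_Un_le) auto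
  also have "\<dots> \<le> 2 * exp (- a\<^sup>2 / 2)"
    using std_normal_tail[OF assms(2)] by simp
  finally show ?thesis .
qed

lemma indep_var_blocks:
  assumes "A \<inter> B = {}" "A \<subseteq> I" "B \<subseteq> I"
    "f \<in> PiM A (\<lambda>_. borel) \<rightarrow>\<^sub>M N" "h \<in> PiM B (\<lambda>_. borel) \<rightarrow>\<^sub>M N'"
  shows "indep_var N (\<lambda>\<omega>. f (\<lambda>i\<in>A. X i \<omega>)) N' (\<lambda>\<omega>. h (\<lambda>i\<in>B. X i \<omega>))"
  using indep_var_compose[OF indep_var_restrict[OF indep assms(1-3)] assms(4,5)]
  by (simp add: comp_def)

lemma prob_blocks:
  assumes "A \<inter> B = {}" "A \<subseteq> I" "B \<subseteq> I"
    "E \<in> sets (PiM A (\<lambda>_. borel))" "F \<in> sets (PiM B (\<lambda>_. borel))"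
  shows "prob {\<omega> \<in> space M. (\<lambda>i\<in>A. X i \<omega>) \<in> E \<and> (\<lambda>i\<in>B. X i \<omega>) \<in> F}
    = prob {\<omega> \<in> space M. (\<lambda>i\<in>A. X i \<omega>) \<in> E} * prob {\<omega> \<in> space M. (\<lambda>i\<in>B. X i \<omega>) \<in> F}"
proof -
  have "{\<omega> \<in> space M. (\<lambda>i\<in>A. X i \<omega>) \<in> E \<and> (\<lambda>i\<in>B. X i \<omega>) \<in> F}
      = (\<lambda>\<omega>. (\<lambda>i\<in>A. X i \<omega>, \<lambda>i\<in>B. X i \<omega>)) -` (E \<times> F) \<inter> space M"
    "{\<omega> \<in> space M. (\<lambda>i\<in>A. X i \<omega>) \<in> E} = (\<lambda>\<omega>. \<lambda>i\<in>A. X i \<omega>) -` E \<inter> space M"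
    "{\<omega> \<in> space M. (\<lambda>i\<in>B. X i \<omega>) \<in> F} = (\<lambda>\<omega>. \<lambda>i\<in>B. X i \<omega>) -` F \<inter> space M"
    by auto
  then show ?thesis
    using indep_varD[OF indep_var_restrict[OF indep assms(1-3)] assms(4,5)] by simp
qed

lemma indep_pair:
  assumes "i \<in> I" "j \<in> I" "i \<noteq> j"
  shows "indep_var borel (X i) borel (X j)"
proof -
  have "indep_var borel (\<lambda>\<omega>. (\<lambda>f. f i) (\<lambda>k\<in>{i}. X k \<omega>)) borel (\<lambda>\<omega>. (\<lambda>f. f j) (\<lambda>k\<in>{j}. X k \<omega>))"
    using assms by (intro indep_var_blocks) auto
  then show ?thesis by simp
qed

lemma integrable_mult_X: "i \<in> I \<Longrightarrow> j \<in> I \<Longrightarrow> integrable M (\<lambda>\<omega>. X i \<omega> * X j \<omega>)"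
  and integral_mult_X: "i \<in> I \<Longrightarrow> j \<in> I \<Longrightarrow> (\<integral>\<omega>. X i \<omega> * X j \<omega> \<partial>M) = of_bool (i = j)"
proof -
  have int1: "integrable M (X i)" and mean: "(\<integral>\<omega>. X i \<omega> \<partial>M) = 0" if "i \<in> I" for i
    using distributed_integrable[OF normal[OF that], of "\<lambda>x. x"]
      integrable_std_normal_moment[of 1] standard_normal_distributed_expectation[OF normal[OF that]]
    by auto
  have sq: "integrable M (\<lambda>\<omega>. X i \<omega> * X i \<omega>)" "(\<integral>\<omega>. X i \<omega> * X i \<omega> \<partial>M) = 1" if "i \<in> I" for i
    using distributed_integrable[OF normal[OF that], of "\<lambda>x. x\<^sup>2"] integrable_std_normal_moment[of 2]
      distributed_integral[OF normal[OF that], of "\<lambda>x. x\<^sup>2"] integral_std_normal_moment_even[of 1]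
    by (auto simp: power2_eq_square fact_numeral)
  assume ij: "i \<in> I" "j \<in> I"
  show "integrable M (\<lambda>\<omega>. X i \<omega> * X j \<omega>)"
    using sq(1)[of i] ij indep_var_integrable[OF indep_pair[OF ij] int1 int1] by (cases "i = j") auto
  show "(\<integral>\<omega>. X i \<omega> * X j \<omega> \<partial>M) = of_bool (i = j)"
    using sq(2)[of i] ij indep_var_lebesgue_integral[OF indep_pair[OF ij] int1 int1] mean
    by (cases "i = j") auto
qed

lemma second_moment:
  assumes "finite J" "J \<subseteq> I"
  shows "integrable M (\<lambda>\<omega>. (\<Sum>i\<in>J. c i * X i \<omega>)\<^sup>2)"
    and "(\<integral>\<omega>. (\<Sum>i\<in>J. c i * X i \<omega>)\<^sup>2 \<partial>M) = (\<Sum>i\<in>J. (c i)\<^sup>2)"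
proof -
  have eq: "(\<Sum>i\<in>J. c i * X i \<omega>)\<^sup>2 = (\<Sum>i\<in>J. \<Sum>j\<in>J. c i * c j * (X i \<omega> * X j \<omega>))" for \<omega>
    by (simp add: power2_eq_square sum_product mult_ac)
  have int: "integrable M (\<lambda>\<omega>. c i * c j * (X i \<omega> * X j \<omega>))" if "i \<in> J" "j \<in> J" for i j
    using that assms by (intro integrable_mult_right integrable_mult_X) auto
  show "integrable M (\<lambda>\<omega>. (\<Sum>i\<in>J. c i * X i \<omega>)\<^sup>2)"
    unfolding eq by (intro Bochner_Integration.integrable_sum int)
  have "(\<integral>\<omega>. (\<Sum>i\<in>J. c i * X i \<omega>)\<^sup>2 \<partial>M)
      = (\<Sum>i\<in>J. \<integral>\<omega>. (\<Sum>j\<in>J. c i * c j * (X i \<omega> * X j \<omega>)) \<partial>M)"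
    unfolding eq by (intro Bochner_Integration.integral_sum Bochner_Integration.integrable_sum int)
  also have "\<dots> = (\<Sum>i\<in>J. \<Sum>j\<in>J. \<integral>\<omega>. c i * c j * (X i \<omega> * X j \<omega>) \<partial>M)"
    by (intro sum.cong refl Bochner_Integration.integral_sum int)
  also have "\<dots> = (\<Sum>i\<in>J. \<Sum>j\<in>J. c i * c j * of_bool (i = j))"
    using assms by (intro sum.cong refl) (simp add: integral_mult_X subset_iff)
  also have "\<dots> = (\<Sum>i\<in>J. (c i)\<^sup>2)"
    using assms(1) by (intro sum.cong refl) (simp add: power2_eq_square of_bool_def if_distrib cong: if_cong)
  finally show "(\<integral>\<omega>. (\<Sum>i\<in>J. c i * X i \<omega>)\<^sup>2 \<partial>M) = (\<Sum>i\<in>J. (c i)\<^sup>2)" .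
qed

text \<open>Fubini, given the variables in \<open>J\<close>: the window then has a fixed midpoint
  and length 4, so the independent \<open>X i\<close> hits it with probability at most
  \<open>q\<close>.\<close>

lemma prob_window_le:
  assumes "i \<in> I" "i \<notin> J" "J \<subseteq> I"
    and B[measurable]: "B \<in> sets (PiM J (\<lambda>_. borel))"
    and W[measurable]: "W \<in> borel_measurable (PiM J (\<lambda>_. borel))"
    and q: "\<And>c. measure std_normal {c - 2..c + 2} \<le> q"
  shows "prob {\<omega> \<in> space M. (\<lambda>j\<in>J. X j \<omega>) \<in> B \<and> \<bar>X i \<omega> - W (\<lambda>j\<in>J. X j \<omega>)\<bar> \<le> 2}
    \<le> q * prob {\<omega> \<in> space M. (\<lambda>j\<in>J. X j \<omega>) \<in> B}"
proof -
  interpret N: prob_space std_normal by (rule prob_space_std_normal)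
  let ?P = "PiM J (\<lambda>_. borel :: real measure)"
  define Y where "Y = (\<lambda>\<omega>. \<lambda>j\<in>J. X j \<omega>)"
  have Y_eq: "(\<lambda>j\<in>J. X j \<omega>) = Y \<omega>" for \<omega> by (simp add: Y_def)
  have Y[measurable]: "Y \<in> M \<rightarrow>\<^sub>M ?P"
    unfolding Y_def by (rule measurable_restrict_X[OF assms(3)])
  have X[measurable]: "X i \<in> borel_measurable M"
    using measurable_X assms by simp
  have q0: "0 \<le> q" using q[of 0] measure_nonneg[of std_normal] by (meson order_trans)
  \<comment> \<open>The single variable is treated as a family over \<open>{i}\<close>, the form in
    which \<open>indep_var_restrict\<close> delivers its independence from the block
    \<open>J\<close>.\<close>
  let ?P' = "PiM {i} (\<lambda>_. borel :: real measure)" and ?N = "PiM {i} (\<lambda>_. std_normal)"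
  define V where "V = (\<lambda>\<omega>. \<lambda>k\<in>{i}. X k \<omega>)"
  have V[measurable]: "V \<in> M \<rightarrow>\<^sub>M ?P'"
    unfolding V_def using assms by (intro measurable_restrict_X) auto
  have V_i: "V \<omega> i = X i \<omega>" for \<omega> by (simp add: V_def)
  interpret N': prob_space ?N by (intro prob_space_PiM prob_space_std_normal)
  have "indep_var ?P Y ?P' V"
    unfolding Y_def V_def using assms by (intro indep_var_restrict[OF indep]) auto
  moreover have "distr M ?P' V = ?N" unfolding V_def using assms by (intro law) auto
  ultimately have joint: "distr M ?P Y \<Otimes>\<^sub>M ?N = distr M (?P \<Otimes>\<^sub>M ?P') (\<lambda>\<omega>. (Y \<omega>, V \<omega>))"
    by (simp add: indep_var_distribution_eq)
  define A where "A = {p \<in> space (?P \<Otimes>\<^sub>M ?P'). fst p \<in> B \<and> \<bar>snd p i - W (fst p)\<bar> \<le> 2}"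
  have A[measurable]: "A \<in> sets (?P \<Otimes>\<^sub>M ?P')"
    unfolding A_def by measurable
  have setsA: "A \<in> sets (distr M ?P Y \<Otimes>\<^sub>M ?N)"
    unfolding joint using A by simp
  have "emeasure M {\<omega> \<in> space M. Y \<omega> \<in> B \<and> \<bar>X i \<omega> - W (Y \<omega>)\<bar> \<le> 2}
      = emeasure (distr M (?P \<Otimes>\<^sub>M ?P') (\<lambda>\<omega>. (Y \<omega>, V \<omega>))) A"
    using measurable_space[OF Y] measurable_space[OF V]
    by (subst emeasure_distr)
      (auto simp: A_def V_i space_pair_measure intro!: arg_cong[where f = "emeasure M"])
  also have "\<dots> = (\<integral>\<^sup>+y. emeasure ?N (Pair y -` A) \<partial>distr M ?P Y)"
    unfolding joint[symmetric] by (rule N'.emeasure_pair_measure_alt[OF setsA])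
  also have "\<dots> \<le> (\<integral>\<^sup>+y. ennreal q * indicator B y \<partial>distr M ?P Y)"
  proof (rule nn_integral_mono)
    fix y
    have "emeasure ?N (Pair y -` A) \<le> emeasure ?N ((\<lambda>f. f i) -` {W y - 2..W y + 2} \<inter> space ?N)"
      by (intro emeasure_mono) (auto simp: A_def abs_le_iff space_pair_measure space_PiM)
    also have "\<dots> = emeasure (distr ?N std_normal (\<lambda>f. f i)) {W y - 2..W y + 2}"
      by (subst emeasure_distr) auto
    also have "\<dots> \<le> ennreal q"
      using q distr_PiM_component[of "{i}" "\<lambda>_. std_normal" i] prob_space_std_normal
      by (simp add: N.emeasure_eq_measure ennreal_leI)
    finally show "emeasure ?N (Pair y -` A) \<le> ennreal q * indicator B y"
      by (cases "y \<in> B") (auto simp: A_def)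
  qed
  also have "\<dots> = ennreal q * emeasure M {\<omega> \<in> space M. Y \<omega> \<in> B}"
    by (simp add: nn_integral_cmult_indicator emeasure_distr vimage_def Int_def conj_commute)
  finally show ?thesis
    unfolding Y_eq using q0
    by (simp add: emeasure_eq_measure flip: ennreal_mult)
qed

end

text \<open>Makes the locale available on product spaces; \<open>gaussian_pigeonhole\<close> builds
  its two copies there.\<close>

lemma std_normal_family_PiM:
  "std_normal_family (PiM I (\<lambda>_. std_normal)) (\<lambda>i \<omega>. \<omega> i) I"
proof -
  interpret P: prob_space "PiM I (\<lambda>_. std_normal)"
    by (intro prob_space_PiM prob_space_std_normal)
  have comp: "distr (PiM I (\<lambda>_. std_normal)) borel (\<lambda>\<omega>. \<omega> i) = std_normal" if "i \<in> I" for i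
    using distr_PiM_component[of I "\<lambda>_. std_normal" i] that prob_space_std_normal
    by (simp cong: distr_cong)
  have sets: "sets (PiM I (\<lambda>_. borel :: real measure)) = sets (PiM I (\<lambda>_. std_normal))"
    by (intro sets_PiM_cong) auto
  show ?thesis
  proof
    show "P.indep_vars (\<lambda>_. borel) (\<lambda>i \<omega>. \<omega> i) I"
    proof (cases "I = {}")
      case False
      have "distr (PiM I (\<lambda>_. std_normal)) (PiM I (\<lambda>_. borel)) (\<lambda>x. \<lambda>i\<in>I. x i)
          = distr (PiM I (\<lambda>_. std_normal)) (PiM I (\<lambda>_. std_normal)) (\<lambda>x. x)"
        by (intro distr_cong refl sets) (auto simp: space_PiM)
      also have "\<dots> = PiM I (\<lambda>i. distr (PiM I (\<lambda>_. std_normal)) borel (\<lambda>\<omega>. \<omega> i))"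
        by (simp add: distr_id) (intro PiM_cong refl, simp add: comp)
      finally show ?thesis
        using False by (subst P.indep_vars_iff_distr_eq_PiM') auto
    next
      case True
      then show ?thesis unfolding P.indep_vars_def2 P.indep_sets_def by auto
    qed
    show "distributed (PiM I (\<lambda>_. std_normal)) lborel (\<lambda>\<omega>. \<omega> i) (\<lambda>x. ennreal (std_normal_density x))"
      if "i \<in> I" for i
      using comp[OF that] that by (auto simp: distributed_def cong: distr_cong)
  qed
qed


text \<open>Functions of disjoint blocks are independent, so only the marginal laws remain to be
  checked. Serves both for the two copies and for their normalized difference.\<close>

lemma (in std_normal_family) law_of_block_combinations:
  assumes K: "\<And>j. j \<in> J \<Longrightarrow> K j \<subseteq> I" "disjoint_family_on K J"
    and h: "\<And>j. j \<in> J \<Longrightarrow> h j \<in> borel_measurable (PiM (K j) (\<lambda>_. borel))"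
    and Y: "\<And>j \<omega>. j \<in> J \<Longrightarrow> Y j \<omega> = h j (\<lambda>i\<in>K j. X i \<omega>)"
    and dist: "\<And>j. j \<in> J \<Longrightarrow> distributed M lborel (Y j) (\<lambda>x. ennreal (std_normal_density x))"
  shows "std_normal_family M Y J"
proof
  have "indep_vars (\<lambda>_. borel) (\<lambda>j \<omega>. h j (\<lambda>i\<in>K j. X i \<omega>)) J"
    by (rule indep_vars_compose2[OF indep_vars_restrict[OF indep K] h])
  then show "indep_vars (\<lambda>_. borel) Y J"
    using Y by (subst indep_vars_cong[where Y = "\<lambda>j \<omega>. h j (\<lambda>i\<in>K j. X i \<omega>)"]) auto
qed (rule dist)

text \<open>Two independent copies of a Gaussian vector that share a cell of a grid differ by little, and
  their difference is again distributed as \<open>sqrt 2\<close> times the vector; so counting cells bounds the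
  small ball probability from below without any correlation inequality.\<close>

lemma gaussian_pigeonhole:
  fixes L :: "'u \<Rightarrow> ('i \<Rightarrow> real) \<Rightarrow> real" and I :: "'i set"
  defines "Q \<equiv> PiM I (\<lambda>_. std_normal)"
  assumes "I \<noteq> {}" "finite U"
    and L[measurable]: "\<And>u. u \<in> U \<Longrightarrow> L u \<in> borel_measurable (PiM I (\<lambda>_. borel))"
    and lin: "\<And>u x y. u \<in> U \<Longrightarrow>
      L u (\<lambda>i\<in>I. (x i - y i) / sqrt 2) = (L u (restrict x I) - L u (restrict y I)) / sqrt 2"
    and B: "B \<in> sets (PiM I (\<lambda>_. borel))"
    and bound: "\<And>u x. u \<in> U \<Longrightarrow> x \<in> B \<Longrightarrow> \<bar>L u x\<bar> \<le> A u"
    and w: "0 < w" "\<And>u. u \<in> U \<Longrightarrow> w \<le> A u"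
  shows "(measure Q B)\<^sup>2 * (\<Prod>u\<in>U. w / (4 * A u))
    \<le> measure Q {x \<in> space Q. \<forall>u\<in>U. \<bar>L u x\<bar> \<le> w / sqrt 2}"
proof -
  let ?P = "PiM I (\<lambda>_. borel :: real measure)"
  \<comment> \<open>The Boolean tag tells the two copies apart.\<close>
  let ?R = "PiM (I \<times> (UNIV :: bool set)) (\<lambda>_. std_normal)"
  interpret F: std_normal_family ?R "\<lambda>i \<omega>. \<omega> i" "I \<times> (UNIV :: bool set)"
    by (rule std_normal_family_PiM)
  have Q: "prob_space Q" unfolding Q_def by (intro prob_space_PiM prob_space_std_normal)
  interpret Q: prob_space Q by fact
  have setsQ: "sets Q = sets ?P" unfolding Q_def by (intro sets_PiM_cong) auto
  have spaceQ: "space Q = space ?P" using setsQ by (rule sets_eq_imp_space_eq)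
  define copy where "copy b \<omega> = (\<lambda>i\<in>I. \<omega> (i, b))" for b :: bool and \<omega> :: "'i \<times> bool \<Rightarrow> real"
  define diff where "diff \<omega> = (\<lambda>i\<in>I. (\<omega> (i, False) - \<omega> (i, True)) / sqrt 2)"
    for \<omega> :: "'i \<times> bool \<Rightarrow> real"
  have copy: "std_normal_family ?R (\<lambda>i \<omega>. \<omega> (i, b)) I" for b
    by (rule F.law_of_block_combinations[where K = "\<lambda>j. {(j, b)}" and h = "\<lambda>j f. f (j, b)"])
      (auto simp: disjoint_family_on_def F.normal)
  have diff: "std_normal_family ?R (\<lambda>i \<omega>. (\<omega> (i, False) - \<omega> (i, True)) / sqrt 2) I"
  proof (rule F.law_of_block_combinations[where K = "\<lambda>j. {(j, False), (j, True)}"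
        and h = "\<lambda>j f. (f (j, False) - f (j, True)) / sqrt 2"])
    fix j assume j: "j \<in> I"
    have "distributed ?R lborel (\<lambda>\<omega>. \<omega> (j, False) - \<omega> (j, True))
        (\<lambda>x. ennreal (normal_density (0 - 0) (sqrt (1\<^sup>2 + 1\<^sup>2)) x))"
      using j by (intro F.diff_indep_normal F.indep_pair F.normal) auto
    from F.normal_density_affine[OF this, of "1 / sqrt 2" 0]
    show "distributed ?R lborel (\<lambda>\<omega>. (\<omega> (j, False) - \<omega> (j, True)) / sqrt 2)
        (\<lambda>x. ennreal (std_normal_density x))"
      by simp
  qed (auto simp: disjoint_family_on_def)
  have prob_copy: "F.prob {\<omega> \<in> space ?R. copy b \<omega> \<in> E} = measure Q E" if "E \<in> sets ?P" for b E
    unfolding copy_def Q_def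
    using std_normal_family.prob_restrict[OF copy subset_refl assms(2) that] .
  have prob_diff: "F.prob {\<omega> \<in> space ?R. diff \<omega> \<in> E} = measure Q E" if "E \<in> sets ?P" for E
    unfolding diff_def Q_def
    using std_normal_family.prob_restrict[OF diff subset_refl assms(2) that] .
  have meas_copy[measurable]: "copy b \<in> ?R \<rightarrow>\<^sub>M ?P" for b
    unfolding copy_def by (rule std_normal_family.measurable_restrict_X[OF copy subset_refl])
  have meas_diff[measurable]: "diff \<in> ?R \<rightarrow>\<^sub>M ?P"
    unfolding diff_def by (rule std_normal_family.measurable_restrict_X[OF diff subset_refl])
  have prob_both: "F.prob {\<omega> \<in> space ?R. copy False \<omega> \<in> E \<and> copy True \<omega> \<in> E} = (measure Q E)\<^sup>2"
    if E[measurable]: "E \<in> sets ?P" for E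
  proof -
    let ?E = "\<lambda>b. {f \<in> space (PiM (I \<times> {b}) (\<lambda>_. borel :: real measure)). (\<lambda>i\<in>I. f (i, b)) \<in> E}"
    have sets: "?E b \<in> sets (PiM (I \<times> {b}) (\<lambda>_. borel))" for b
      by measurable
    have eq: "(\<lambda>i\<in>I \<times> {b}. \<omega> i) \<in> ?E b \<longleftrightarrow> copy b \<omega> \<in> E" for b \<omega>
      by (simp add: copy_def space_PiM cong: restrict_cong)
    show ?thesis
      using F.prob_blocks[of "I \<times> {False}" "I \<times> {True}", OF _ _ _ sets sets]
      unfolding eq by (auto simp: prob_copy power2_eq_square)
  qed
  \<comment> \<open>A grid of mesh \<open>w\<close> on the values of the linear forms:
    \<open>\<beta> x\<close> labels the grid cell of \<open>x\<close>, and the finite set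
    \<open>\<Phi>\<close> contains the labels of all cells met by \<open>B\<close>.\<close>
  define \<beta> where "\<beta> x = (\<lambda>u\<in>U. \<lfloor>L u x / w\<rfloor>)" for x
  define \<Phi> where "\<Phi> = (\<Pi>\<^sub>E u\<in>U. {\<lfloor>- (A u / w)\<rfloor>..\<lfloor>A u / w\<rfloor>})"
  define E where "E f = {x \<in> B. \<beta> x = f}" for f
  have fin: "finite \<Phi>" unfolding \<Phi>_def using assms(3) by (intro finite_PiE) auto
  have card: "real (card \<Phi>) \<le> (\<Prod>u\<in>U. 4 * A u / w)"
  proof -
    have "real (card {\<lfloor>- (A u / w)\<rfloor>..\<lfloor>A u / w\<rfloor>}) \<le> 4 * A u / w" if "u \<in> U" for u
    proof -
      have a: "1 \<le> A u / w" using w that by (simp add: field_simps)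
      then have "real (card {\<lfloor>- (A u / w)\<rfloor>..\<lfloor>A u / w\<rfloor>}) = of_int (\<lfloor>A u / w\<rfloor> - \<lfloor>- (A u / w)\<rfloor> + 1)"
        by (simp add: floor_mono)
      \<comment> \<open>With a = \<open>A u / w\<close> the count is at most 2 a + 2, and a >= 1
        because \<open>w \<le> A u\<close>.\<close>
      also have "\<dots> \<le> 4 * (A u / w)" using a by linarith
      finally show ?thesis by simp
    qed
    then show ?thesis
      unfolding \<Phi>_def card_PiE[OF assms(3)] by (auto intro!: prod_mono)
  qed
  have B_sub: "B \<subseteq> space ?P" using B by (rule sets.sets_into_space)
  have in_\<Phi>: "\<beta> x \<in> \<Phi>" if "x \<in> B" for x
  proof -
    have "\<lfloor>L u x / w\<rfloor> \<in> {\<lfloor>- (A u / w)\<rfloor>..\<lfloor>A u / w\<rfloor>}" if "u \<in> U" for u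
      using bound[OF that \<open>x \<in> B\<close>] w(1)
      by (auto intro!: floor_mono simp: field_simps abs_le_iff minus_divide_left[symmetric]
          simp del: minus_divide_left)
    then show ?thesis by (auto simp: \<beta>_def \<Phi>_def)
  qed
  have E_sets: "E f \<in> sets ?P" if "f \<in> \<Phi>" for f
  proof -
    have "E f = B \<inter> {x \<in> space ?P. \<forall>u\<in>U. \<lfloor>L u x / w\<rfloor> = f u}"
      using that B_sub by (force simp: E_def \<beta>_def \<Phi>_def PiE_def extensional_def fun_eq_iff restrict_def)
    also have "\<dots> \<in> sets ?P"
    proof (intro sets.Int sets.sets_Collect_finite_All B assms(3))
      fix u assume "u \<in> U"
      note [measurable] = L[OF this]
      show "{x \<in> space ?P. \<lfloor>L u x / w\<rfloor> = f u} \<in> sets ?P"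
        unfolding floor_eq_iff by measurable
    qed
    finally show ?thesis .
  qed
  have "measure Q B = measure Q (\<Union>f\<in>\<Phi>. E f)"
    using in_\<Phi> by (intro arg_cong[where f = "measure Q"]) (auto simp: E_def)
  also have "\<dots> = (\<Sum>f\<in>\<Phi>. measure Q (E f))"
    using fin E_sets setsQ
    by (intro Q.finite_measure_finite_Union) (auto simp: disjoint_family_on_def E_def)
  \<comment> \<open>Cauchy-Schwarz over the grid cells.\<close>
  finally have "(measure Q B)\<^sup>2 \<le> (\<Sum>f\<in>\<Phi>. (measure Q (E f))\<^sup>2) * real (card \<Phi>)"
    using sum_squared_le_sum_of_squares[of "\<lambda>f. measure Q (E f)" \<Phi>] by simp
  also have "\<dots> \<le> (\<Sum>f\<in>\<Phi>. (measure Q (E f))\<^sup>2) * (\<Prod>u\<in>U. 4 * A u / w)"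
    by (intro mult_left_mono card sum_nonneg) auto
  finally have 1: "(measure Q B)\<^sup>2 \<le> (\<Sum>f\<in>\<Phi>. (measure Q (E f))\<^sup>2) * (\<Prod>u\<in>U. 4 * A u / w)" .
  define G where "G = {x \<in> space ?P. \<forall>u\<in>U. \<bar>L u x\<bar> \<le> w / sqrt 2}"
  have G[measurable]: "G \<in> sets ?P"
    unfolding G_def using assms(3) by (intro sets.sets_Collect_finite_All) measurable
  let ?D = "\<lambda>f. {\<omega> \<in> space ?R. copy False \<omega> \<in> E f \<and> copy True \<omega> \<in> E f}"
  have D_sets: "?D f \<in> sets ?R" if "f \<in> \<Phi>" for f
    using E_sets[OF that] by measurable
  \<comment> \<open>By independence each square is the probability that both copies land in the same
    \<open>E f\<close>, where the values of every linear form at the two copies differ by at most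
    \<open>w\<close>.\<close>
  have "(\<Sum>f\<in>\<Phi>. (measure Q (E f))\<^sup>2) = (\<Sum>f\<in>\<Phi>. F.prob (?D f))"
    using prob_both E_sets by simp
  also have "\<dots> = F.prob (\<Union>f\<in>\<Phi>. ?D f)"
    using fin D_sets
    by (intro F.finite_measure_finite_Union[symmetric]) (auto simp: disjoint_family_on_def E_def)
  also have "\<dots> \<le> F.prob {\<omega> \<in> space ?R. diff \<omega> \<in> G}"
  proof (intro F.finite_measure_mono subsetI)
    fix \<omega> assume "\<omega> \<in> (\<Union>f\<in>\<Phi>. ?D f)"
    then have \<omega>: "\<omega> \<in> space ?R" "\<beta> (copy False \<omega>) = \<beta> (copy True \<omega>)" by (auto simp: E_def)
    have "\<bar>L u (diff \<omega>)\<bar> \<le> w / sqrt 2" if u: "u \<in> U" for u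
    proof -
      have "\<lfloor>L u (copy False \<omega>) / w\<rfloor> = \<lfloor>L u (copy True \<omega>) / w\<rfloor>"
        using fun_cong[OF \<omega>(2), of u] u by (simp add: \<beta>_def)
      then have "\<bar>L u (copy False \<omega>) / w - L u (copy True \<omega>) / w\<bar> \<le> 1" by linarith
      then have "\<bar>L u (copy False \<omega>) - L u (copy True \<omega>)\<bar> \<le> w"
        using w(1) by (simp add: abs_le_iff field_simps)
      moreover have "L u (diff \<omega>) = (L u (copy False \<omega>) - L u (copy True \<omega>)) / sqrt 2"
        using lin[OF u, of "\<lambda>i. \<omega> (i, False)" "\<lambda>i. \<omega> (i, True)"] by (simp add: diff_def copy_def)
      ultimately show ?thesis by (simp add: divide_right_mono)
    qed
    then show "\<omega> \<in> {\<omega> \<in> space ?R. diff \<omega> \<in> G}"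
      using \<omega>(1) measurable_space[OF meas_diff] by (auto simp: G_def)
  qed measurable
  also have "\<dots> = measure Q G" by (rule prob_diff) measurable
  finally have 2: "(\<Sum>f\<in>\<Phi>. (measure Q (E f))\<^sup>2) \<le> measure Q G" .
  have pos: "0 < A u" if "u \<in> U" for u using w(1) w(2)[OF that] by linarith
  then have "0 < (\<Prod>u\<in>U. 4 * A u / w)" using w(1) by (intro prod_pos) auto
  moreover from this have "(measure Q B)\<^sup>2 \<le> measure Q G * (\<Prod>u\<in>U. 4 * A u / w)"
    using order_trans[OF 1 mult_right_mono[OF 2]] by simp
  moreover have "(\<Prod>u\<in>U. w / (4 * A u)) = inverse (\<Prod>u\<in>U. 4 * A u / w)"
    unfolding prod_inversef[symmetric] by (simp add: comp_def)
  ultimately show ?thesis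
    unfolding G_def spaceQ by (simp add: pos_divide_le_eq flip: divide_inverse)
qed

section \<open>The upper bound\<close>

text \<open>No independence is involved: the series of \<open>a n * (Y n \<omega>)\<^sup>2\<close>
  has finite expectation, and |y| <= 1 + y^2 turns its convergence into that of
  \<open>a n * Y n \<omega>\<close>. By Cauchy-Schwarz with the weights split as square roots, the
  same series times \<open>suminf a\<close> dominates the squared partial sums.\<close>

lemma (in prob_space) weighted_series_L2:
  fixes a :: "nat \<Rightarrow> real" and Y :: "nat \<Rightarrow> 'a \<Rightarrow> real"
  assumes a: "\<And>n. 0 \<le> a n" "summable a"
    and Y[measurable]: "\<And>n. Y n \<in> borel_measurable M"
    and int: "\<And>n. integrable M (\<lambda>\<omega>. (Y n \<omega>)\<^sup>2)"
    and le: "\<And>n. (\<integral>\<omega>. (Y n \<omega>)\<^sup>2 \<partial>M) \<le> K"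
  shows "AE \<omega> in M. summable (\<lambda>n. a n * Y n \<omega>)"
    and "(\<lambda>N. \<integral>\<omega>. (\<Sum>n<N. a n * Y n \<omega>)\<^sup>2 \<partial>M) \<longlonglongrightarrow> (\<integral>\<omega>. (\<Sum>n. a n * Y n \<omega>)\<^sup>2 \<partial>M)"
proof -
  have sum_int: "summable (\<lambda>n. \<integral>\<omega>. norm (a n * (Y n \<omega>)\<^sup>2) \<partial>M)"
  proof (rule summable_comparison_test'[where N = 0])
    show "summable (\<lambda>n. a n * K)" using a(2) by (rule summable_mult2)
    show "norm (\<integral>\<omega>. norm (a n * (Y n \<omega>)\<^sup>2) \<partial>M) \<le> a n * K" for n
      using a(1)[of n] le[of n] by (simp add: abs_mult mult_left_mono)
  qed
  have ae: "AE \<omega> in M. summable (\<lambda>n. a n * (Y n \<omega>)\<^sup>2)"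
  proof -
    have "(\<integral>\<^sup>+\<omega>. (\<Sum>n. ennreal (a n * (Y n \<omega>)\<^sup>2)) \<partial>M) = (\<Sum>n. \<integral>\<^sup>+\<omega>. ennreal (a n * (Y n \<omega>)\<^sup>2) \<partial>M)"
      by (rule nn_integral_suminf) measurable
    also have "\<dots> = (\<Sum>n. ennreal (\<integral>\<omega>. a n * (Y n \<omega>)\<^sup>2 \<partial>M))"
      using a int by (intro suminf_cong nn_integral_eq_integral) auto
    also have "\<dots> \<noteq> \<infinity>"
      using sum_int a by (simp add: suminf_ennreal2 integral_nonneg_AE abs_mult)
    finally have "AE \<omega> in M. (\<Sum>n. ennreal (a n * (Y n \<omega>)\<^sup>2)) \<noteq> \<infinity>"
      by (intro nn_integral_noteq_infinite) auto
    then show ?thesis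
      using a by (auto elim!: eventually_mono intro!: summable_suminf_not_top)
  qed
  have conv: "summable (\<lambda>n. a n * y n)" if "summable (\<lambda>n. a n * (y n)\<^sup>2)" for y
  proof (rule summable_comparison_test'[where N = 0])
    show "summable (\<lambda>n. a n + a n * (y n)\<^sup>2)" using a(2) that by (rule summable_add)
    show "norm (a n * y n) \<le> a n + a n * (y n)\<^sup>2" for n
    proof -
      have "2 * \<bar>y n\<bar> \<le> 1 + (y n)\<^sup>2"
        using zero_le_power2[of "\<bar>y n\<bar> - 1"] by (simp add: power2_diff)
      then have "\<bar>y n\<bar> \<le> 1 + (y n)\<^sup>2" by simp
      from mult_left_mono[OF this a(1)[of n]] a(1)[of n] show ?thesis
        by (simp add: abs_mult algebra_simps)
    qed
  qed
  then show "AE \<omega> in M. summable (\<lambda>n. a n * Y n \<omega>)"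
    using ae by (auto elim!: eventually_mono)
  show "(\<lambda>N. \<integral>\<omega>. (\<Sum>n<N. a n * Y n \<omega>)\<^sup>2 \<partial>M) \<longlonglongrightarrow> (\<integral>\<omega>. (\<Sum>n. a n * Y n \<omega>)\<^sup>2 \<partial>M)"
  proof (rule integral_dominated_convergence[where w = "\<lambda>\<omega>. suminf a * (\<Sum>n. a n * (Y n \<omega>)\<^sup>2)"])
    have "AE \<omega> in M. summable (\<lambda>n. norm (a n * (Y n \<omega>)\<^sup>2))"
      using ae a by (auto elim!: eventually_mono simp: abs_mult)
    then show "integrable M (\<lambda>\<omega>. suminf a * (\<Sum>n. a n * (Y n \<omega>)\<^sup>2))"
      using int sum_int by (intro integrable_mult_right integrable_suminf) auto
    show "AE \<omega> in M. (\<lambda>N. (\<Sum>n<N. a n * Y n \<omega>)\<^sup>2) \<longlonglongrightarrow> (\<Sum>n. a n * Y n \<omega>)\<^sup>2"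
      using ae by (auto elim!: eventually_mono intro!: tendsto_power summable_LIMSEQ conv)
    show "AE \<omega> in M. norm ((\<Sum>n<N. a n * Y n \<omega>)\<^sup>2) \<le> suminf a * (\<Sum>n. a n * (Y n \<omega>)\<^sup>2)" for N
      using ae
    proof (rule eventually_mono)
      fix \<omega> assume s: "summable (\<lambda>n. a n * (Y n \<omega>)\<^sup>2)"
      have "(\<Sum>n<N. a n * Y n \<omega>)\<^sup>2 = (\<Sum>n<N. sqrt (a n) * (sqrt (a n) * Y n \<omega>))\<^sup>2"
        using a by (simp flip: mult.assoc)
      also have "\<dots> \<le> (\<Sum>n<N. (sqrt (a n))\<^sup>2) * (\<Sum>n<N. (sqrt (a n) * Y n \<omega>)\<^sup>2)"
        by (rule Cauchy_Schwarz_ineq_sum)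
      also have "\<dots> = (\<Sum>n<N. a n) * (\<Sum>n<N. a n * (Y n \<omega>)\<^sup>2)"
        using a by (simp add: power_mult_distrib)
      also have "\<dots> \<le> suminf a * (\<Sum>n. a n * (Y n \<omega>)\<^sup>2)"
        using a s by (intro mult_mono sum_le_suminf sum_nonneg suminf_nonneg) auto
      finally show "norm ((\<Sum>n<N. a n * Y n \<omega>)\<^sup>2) \<le> suminf a * (\<Sum>n. a n * (Y n \<omega>)\<^sup>2)"
        by simp
    qed
  qed measurable
qed

section \<open>The process and its conditional windows\<close>

locale ultrametric_process =
  ultrametric_nets T d S + std_normal_family M g "Sigma UNIV S"
  for T :: "'a set" and d S and M :: "'b measure" and g
begin

lemma Z_term_embed: "Z_term T d g (limit_embed T d S t) \<omega> n = rad n * g (n, ctr n t) \<omega>"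
  by (simp add: Z_term_def limit_embed_def)

lemma summable_rad: "summable rad"
proof -
  have "rad = (\<lambda>n. diam T d * (1 / 2) ^ n)" by (simp add: fun_eq_iff radius_def power_divide)
  then show ?thesis by (simp add: summable_mult summable_geometric)
qed

lemma index_in: "t \<in> T \<Longrightarrow> (n, ctr n t) \<in> Sigma UNIV S"
  by (simp add: center_in)

lemma AE_summable:
  assumes "t \<in> T"
  shows "AE \<omega> in M. summable (Z_term T d g (limit_embed T d S t) \<omega>)"
proof -
  note in_I = index_in[OF assms]
  have "AE \<omega> in M. summable (\<lambda>n. rad n * g (n, ctr n t) \<omega>)"
  proof (rule weighted_series_L2(1)[where K = 1])
    show "integrable M (\<lambda>\<omega>. (g (n, ctr n t) \<omega>)\<^sup>2)" for n
      using integrable_mult_X[OF in_I in_I] by (simp add: power2_eq_square)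
    show "(\<integral>\<omega>. (g (n, ctr n t) \<omega>)\<^sup>2 \<partial>M) \<le> 1" for n
      using integral_mult_X[OF in_I in_I] by (simp add: power2_eq_square)
  qed (use rad_nonneg summable_rad measurable_X[OF in_I] in auto)
  then show ?thesis by (simp add: Z_term_embed[abs_def])
qed

end

lemma ultrametric_processI: "ultrametric_gaussian T d S M g \<Longrightarrow> ultrametric_process T d S M g"
  unfolding ultrametric_gaussian_def ultrametric_process_def ultrametric_nets_def
    std_normal_family_def std_normal_family_axioms_def by auto

context ultrametric_process
begin

text \<open>Induction on \<open>F\<close>. Among the constraints only the one for the new point
  \<open>u\<close> involves the coordinate \<open>(n, u)\<close>, so conditioning on everything else
  leaves a single window for \<open>g (n, u)\<close>. Level \<open>n\<close> is taken out of the
  series to keep \<open>W\<close> affine in that coordinate even where the remaining series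
  diverges.\<close>

lemma window_chain:
  fixes n :: nat and \<epsilon> q :: real and u0 :: 'a
  defines "W \<equiv> \<lambda>u f. rad n * f (n, u) + (\<Sum>k. if k = n then 0 else rad k * f (k, ctr k u))"
  assumes q: "\<And>c. measure std_normal {c - 2..c + 2} \<le> q"
    and \<epsilon>: "\<epsilon> \<le> 2 * rad n" and u0: "u0 \<in> S n"
    and F: "finite F" "F \<subseteq> S n - {u0}"
  shows "prob {\<omega> \<in> space M. \<forall>u\<in>F. \<bar>W u (\<lambda>i. g i \<omega>) - W u0 (\<lambda>i. g i \<omega>)\<bar> \<le> \<epsilon>} \<le> q ^ card F"
  using F
proof (induction F)
  case (insert u F)
  define J where "J = Sigma UNIV S - {(n, u)}"
  have u: "u \<in> S n" "u \<noteq> u0" using insert by auto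
  have in_J: "(k, ctr k v) \<in> J" if "v \<in> S n" "k \<noteq> n" for v k
    using that center_in[OF net_subset] by (auto simp: J_def)
  have in_J': "(n, v) \<in> J" if "v \<in> S n" "v \<noteq> u" for v using that by (simp add: J_def)
  define R where "R v f = (\<Sum>k. if k = n then 0 else rad k * f (k, ctr k v))" for v f
  have R_meas: "R v \<in> borel_measurable (PiM J (\<lambda>_. borel))" if "v \<in> S n" for v
  proof -
    have [measurable]: "(\<lambda>f. if k = n then 0 else rad k * f (k, ctr k v)) \<in> borel_measurable (PiM J (\<lambda>_. borel))"
      for k using in_J[OF that, of k] by (cases "k = n") auto
    show ?thesis unfolding R_def by measurable
  qed
  have W_R: "W v f = rad n * f (n, v) + R v f" for v f by (simp add: W_def R_def)
  have W_meas: "W v \<in> borel_measurable (PiM J (\<lambda>_. borel))" if "v \<in> S n" "v \<noteq> u" for v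
    using R_meas[OF that(1)] in_J'[OF that] unfolding W_R by simp
  have R_eq: "R v (\<lambda>i\<in>J. g i \<omega>) = R v (\<lambda>i. g i \<omega>)" if "v \<in> S n" for v \<omega>
    unfolding R_def using in_J[OF that] by (intro suminf_cong) auto
  have W_eq: "W v (\<lambda>i\<in>J. g i \<omega>) = W v (\<lambda>i. g i \<omega>)" if "v \<in> S n" "v \<noteq> u" for v \<omega>
    using R_eq[OF that(1)] in_J'[OF that] by (simp add: W_R)
  define B where "B = {f \<in> space (PiM J (\<lambda>_. borel)). \<forall>v\<in>F. \<bar>W v f - W u0 f\<bar> \<le> \<epsilon>}"
  have F: "v \<in> S n" "v \<noteq> u" if "v \<in> F" for v using that insert by auto
  have B: "B \<in> sets (PiM J (\<lambda>_. borel))"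
    unfolding B_def
  proof (intro sets.sets_Collect_finite_All insert.hyps)
    fix v assume "v \<in> F"
    note [measurable] = W_meas[OF F[OF this]] W_meas[OF u0 u(2)[symmetric]]
    show "{f \<in> space (PiM J (\<lambda>_. borel)). \<bar>W v f - W u0 f\<bar> \<le> \<epsilon>} \<in> sets (PiM J (\<lambda>_. borel))"
      by measurable
  qed
  have in_B: "(\<lambda>i\<in>J. g i \<omega>) \<in> B \<longleftrightarrow> (\<forall>v\<in>F. \<bar>W v (\<lambda>i. g i \<omega>) - W u0 (\<lambda>i. g i \<omega>)\<bar> \<le> \<epsilon>)" for \<omega>
    using W_eq[OF F] W_eq[OF u0 u(2)[symmetric]] by (auto simp: B_def space_PiM)
  \<comment> \<open>Midpoint of the window: \<open>W u f - W u0 f\<close> is \<open>rad n\<close>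
    times \<open>f (n, u) - V f\<close>, and \<open>\<epsilon> \<le> 2 * rad n\<close> makes the
    half-width 2.\<close>
  define V where "V f = (W u0 f - R u f) / rad n" for f
  have V: "V \<in> borel_measurable (PiM J (\<lambda>_. borel))"
    unfolding V_def using W_meas[OF u0 u(2)[symmetric]] R_meas[OF u(1)] by measurable
  have V_eq: "V (\<lambda>i\<in>J. g i \<omega>) = (W u0 (\<lambda>i. g i \<omega>) - R u (\<lambda>i. g i \<omega>)) / rad n" for \<omega>
    using W_eq[OF u0 u(2)[symmetric]] R_eq[OF u(1)] by (simp add: V_def)
  have step: "prob {\<omega> \<in> space M. (\<lambda>i\<in>J. g i \<omega>) \<in> B \<and> \<bar>g (n, u) \<omega> - V (\<lambda>i\<in>J. g i \<omega>)\<bar> \<le> 2}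
      \<le> q * prob {\<omega> \<in> space M. (\<lambda>i\<in>J. g i \<omega>) \<in> B}"
    by (rule prob_window_le[OF _ _ _ B V q]) (use u in \<open>auto simp: J_def\<close>)
  have q0: "0 \<le> q" using q[of 0] measure_nonneg[of std_normal] by (meson order_trans)
  have sets: "{\<omega> \<in> space M. (\<lambda>i\<in>J. g i \<omega>) \<in> B \<and> \<bar>g (n, u) \<omega> - V (\<lambda>i\<in>J. g i \<omega>)\<bar> \<le> 2} \<in> sets M"
  proof -
    note [measurable] = B V
    have [measurable]: "(\<lambda>\<omega>. \<lambda>i\<in>J. g i \<omega>) \<in> M \<rightarrow>\<^sub>M PiM J (\<lambda>_. borel)"
      by (rule measurable_restrict_X) (auto simp: J_def)
    have [measurable]: "g (n, u) \<in> borel_measurable M" using u by (intro measurable_X) auto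
    show ?thesis by measurable
  qed
  have win: "\<bar>g (n, u) \<omega> - V (\<lambda>i\<in>J. g i \<omega>)\<bar> \<le> 2"
    if "\<bar>W u (\<lambda>i. g i \<omega>) - W u0 (\<lambda>i. g i \<omega>)\<bar> \<le> \<epsilon>" for \<omega>
  proof -
    have r: "0 < rad n" by (rule rad_pos)
    have "rad n * (g (n, u) \<omega> - V (\<lambda>i\<in>J. g i \<omega>)) = W u (\<lambda>i. g i \<omega>) - W u0 (\<lambda>i. g i \<omega>)"
      using r unfolding V_eq W_R[of u] by (simp add: field_simps)
    then have "rad n * \<bar>g (n, u) \<omega> - V (\<lambda>i\<in>J. g i \<omega>)\<bar> \<le> rad n * 2"
      using that \<epsilon> r by (metis abs_mult abs_of_pos mult.commute order_trans)
    then show ?thesis using r by simp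
  qed
  have "prob {\<omega> \<in> space M. \<forall>u\<in>insert u F. \<bar>W u (\<lambda>i. g i \<omega>) - W u0 (\<lambda>i. g i \<omega>)\<bar> \<le> \<epsilon>}
      \<le> prob {\<omega> \<in> space M. (\<lambda>i\<in>J. g i \<omega>) \<in> B \<and> \<bar>g (n, u) \<omega> - V (\<lambda>i\<in>J. g i \<omega>)\<bar> \<le> 2}"
    using win by (intro finite_measure_mono sets) (auto simp: in_B)
  also have "\<dots> \<le> q * q ^ card F"
    using insert.IH insert.prems by (intro order_trans[OF step] mult_left_mono q0) (auto simp: in_B)
  finally show ?case using insert.hyps by simp
next
  case empty
  show ?case by (simp add: prob_space)
qed

text \<open>An upper bound may forget all points but the embedded ones of \<open>S n\<close>. Their
  finitely many series converge outside a null set \<open>N\<close>, where \<open>Z\<close> agrees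
  with the measurable \<open>W\<close>; so the oscillation event, measurable or not, lies in
  \<open>?G \<union> N\<close>. The reference point \<open>u0\<close> accounts for the one
  subtracted in the exponent.\<close>

lemma small_oscillation_le:
  assumes q: "\<And>c. measure std_normal {c - 2..c + 2} \<le> q"
    and \<epsilon>: "\<epsilon> \<le> 2 * rad n" and ne: "T \<noteq> {}"
  shows "outer_measure_of M (small_oscillation T d M g (proj_limit T d S) \<epsilon>)
    \<le> ennreal (q ^ (card (S n) - 1))"
proof -
  obtain u0 where u0: "u0 \<in> S n" using ne center_in by blast
  define W where "W u f = rad n * f (n, u) + (\<Sum>k. if k = n then 0 else rad k * f (k, ctr k u))"
    for u and f :: "nat \<times> 'a \<Rightarrow> real"
  have W_meas: "(\<lambda>\<omega>. W u (\<lambda>i. g i \<omega>)) \<in> borel_measurable M" if "u \<in> S n" for u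
  proof -
    have [measurable]: "(\<lambda>\<omega>. if k = n then 0 else rad k * g (k, ctr k u) \<omega>) \<in> borel_measurable M" for k
      using measurable_X[OF index_in[OF net_subset[OF that]], of k] by (cases "k = n") auto
    have [measurable]: "g (n, u) \<in> borel_measurable M" using that by (intro measurable_X) auto
    show ?thesis unfolding W_def by measurable
  qed
  let ?G = "{\<omega> \<in> space M. \<forall>u\<in>S n - {u0}. \<bar>W u (\<lambda>i. g i \<omega>) - W u0 (\<lambda>i. g i \<omega>)\<bar> \<le> \<epsilon>}"
  have G: "?G \<in> sets M"
  proof (intro sets.sets_Collect_finite_All)
    show "finite (S n - {u0})" using finite_net by simp
    fix u assume "u \<in> S n - {u0}"
    then have [measurable]: "(\<lambda>\<omega>. W u (\<lambda>i. g i \<omega>)) \<in> borel_measurable M" using W_meas by simp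
    note [measurable] = W_meas[OF u0]
    show "{\<omega> \<in> space M. \<bar>W u (\<lambda>i. g i \<omega>) - W u0 (\<lambda>i. g i \<omega>)\<bar> \<le> \<epsilon>} \<in> sets M" by measurable
  qed
  have "AE \<omega> in M. \<forall>u\<in>S n. summable (Z_term T d g (limit_embed T d S u) \<omega>)"
    using AE_summable net_subset finite_net by (intro AE_finite_allI) auto
  then obtain N where N: "{\<omega> \<in> space M. \<not> (\<forall>u\<in>S n. summable (Z_term T d g (limit_embed T d S u) \<omega>))} \<subseteq> N"
    "emeasure M N = 0" "N \<in> sets M" by (rule AE_E)
  have Z_W: "Z T d g (limit_embed T d S u) \<omega> = W u (\<lambda>i. g i \<omega>)"
    if "u \<in> S n" "summable (Z_term T d g (limit_embed T d S u) \<omega>)" for u \<omega>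
  proof -
    let ?t = "Z_term T d g (limit_embed T d S u) \<omega>"
    have s: "(\<lambda>k. if k = n then ?t k else 0) sums ?t n" by (rule sums_single)
    have "suminf ?t = suminf (\<lambda>k. if k = n then ?t k else 0) + suminf (\<lambda>k. ?t k - (if k = n then ?t k else 0))"
      using that(2) s by (simp add: suminf_diff[symmetric] sums_iff)
    also have "(\<lambda>k. ?t k - (if k = n then ?t k else 0)) = (\<lambda>k. if k = n then 0 else rad k * g (k, ctr k u) \<omega>)"
      by (auto simp: Z_term_embed)
    finally show ?thesis
      using s that(1) by (simp add: Z_def W_def sums_iff Z_term_embed center_net)
  qed
  have "small_oscillation T d M g (proj_limit T d S) \<epsilon> \<subseteq> ?G \<union> N"
  proof (intro subsetI UnCI)
    fix \<omega> assume \<omega>: "\<omega> \<in> small_oscillation T d M g (proj_limit T d S) \<epsilon>" "\<omega> \<notin> N"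
    then have sp: "\<omega> \<in> space M" by (simp add: small_oscillation_def)
    then have sm: "summable (Z_term T d g (limit_embed T d S u) \<omega>)" if "u \<in> S n" for u
      using N(1) \<omega>(2) that by blast
    let ?A = "{x \<in> proj_limit T d S. summable (Z_term T d g x \<omega>)}"
    have sup: "(SUP (x, y)\<in>?A \<times> ?A. ereal \<bar>Z T d g x \<omega> - Z T d g y \<omega>\<bar>) \<le> ereal \<epsilon>"
      using \<omega>(1) by (simp add: small_oscillation_def Let_def)
    have "\<bar>W u (\<lambda>i. g i \<omega>) - W u0 (\<lambda>i. g i \<omega>)\<bar> \<le> \<epsilon>" if u: "u \<in> S n" for u
    proof -
      have "(limit_embed T d S u, limit_embed T d S u0) \<in> ?A \<times> ?A"
        using u u0 sm net_subset limit_embed_in by auto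
      then have "ereal \<bar>Z T d g (limit_embed T d S u) \<omega> - Z T d g (limit_embed T d S u0) \<omega>\<bar>
          \<le> (SUP (x, y)\<in>?A \<times> ?A. ereal \<bar>Z T d g x \<omega> - Z T d g y \<omega>\<bar>)"
        by (rule SUP_upper2) simp
      from order_trans[OF this sup] show ?thesis using Z_W u u0 sm by simp
    qed
    then show "\<omega> \<in> ?G" using sp by simp
  qed
  then have "outer_measure_of M (small_oscillation T d M g (proj_limit T d S) \<epsilon>) \<le> emeasure M (?G \<union> N)"
    unfolding outer_measure_of_def using G N by (intro INF_lower) auto
  also have "\<dots> \<le> emeasure M ?G + emeasure M N"
    using G N by (intro emeasure_subadditive) auto
  also have "\<dots> \<le> ennreal (q ^ card (S n - {u0}))"
    using window_chain[OF q \<epsilon> u0, of "S n - {u0}"] finite_net N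
    by (simp add: emeasure_eq_measure W_def ennreal_leI)
  finally show ?thesis using u0 finite_net by (simp add: card_Diff_singleton)
qed

end

lemma entropy_number_empty: "entropy_number {} d r = 0"
  unfolding entropy_number_def
  by (rule Least_eq_0) (auto simp: ball_cover_def)

lemma small_oscillation_bound:
  "\<exists>\<gamma>>0. \<forall>(T :: 'a set) d S (M :: 'b measure) g.
    ultrametric_gaussian T d S M g \<longrightarrow>
    (\<forall>\<epsilon>. 0 < \<epsilon> \<and> \<epsilon> \<le> diam T d \<longrightarrow>
      outer_measure_of M (small_oscillation T d M g (proj_limit T d S) \<epsilon>)
        \<le> ennreal (exp (- \<gamma> * real (entropy_number T d (2 * \<epsilon>)))))"
proof -
  obtain q where q: "0 < q" "q < 1" "\<And>c. measure std_normal {c - 2..c + 2} \<le> q"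
    using std_normal_interval_bound by blast
  \<comment> \<open>The factor 1/2 pays for the reference point: the level chosen below has at least
    two net points, so \<open>card (S n) - 1\<close> is at least half of
    \<open>card (S n)\<close>.\<close>
  define \<gamma> where "\<gamma> = - ln q / 2"
  have "outer_measure_of M (small_oscillation T d M g (proj_limit T d S) \<epsilon>)
        \<le> ennreal (exp (- \<gamma> * real (entropy_number T d (2 * \<epsilon>))))"
    if ug: "ultrametric_gaussian T d S M g" and \<epsilon>: "0 < \<epsilon>" "\<epsilon> \<le> diam T d"
    for T :: "'a set" and d S and M :: "'b measure" and g \<epsilon>
  proof -
    interpret ultrametric_process T d S M g using ug by (rule ultrametric_processI)
    show ?thesis
    proof (cases "T = {}")
      \<comment> \<open>The supremum of an empty set of reals is unspecified, so a positive
        \<open>diam\<close> does not exclude this case. The claimed bound is then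
        \<open>exp 0\<close>.\<close>
      case True
      have "outer_measure_of M (small_oscillation T d M g (proj_limit T d S) \<epsilon>) \<le> emeasure M (space M)"
        unfolding outer_measure_of_def small_oscillation_def by (intro INF_lower) auto
      then show ?thesis using True by (simp add: entropy_number_empty emeasure_space_1)
    next
      case False
      \<comment> \<open>\<open>rad n \<le> 2 * \<epsilon>\<close> compares the net with the entropy
        number. Leastness gives the opposite estimate \<open>\<epsilon> \<le> 2 * rad n\<close>,
        which for \<open>n = 1\<close> is just \<open>\<epsilon> \<le> diam T d\<close>.\<close>
      define n where "n = (LEAST n. 1 \<le> n \<and> rad n \<le> 2 * \<epsilon>)"
      have "\<exists>n. 1 \<le> n \<and> rad n \<le> 2 * \<epsilon>"
      proof -
        have "eventually (\<lambda>n. norm (rad n) < 2 * \<epsilon>) sequentially"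
          using summable_LIMSEQ_zero[OF summable_rad] \<epsilon>(1) by (simp add: tendsto_iff dist_norm)
        then have "eventually (\<lambda>n. norm (rad n) < 2 * \<epsilon> \<and> 1 \<le> n) sequentially"
          using eventually_ge_at_top by (rule eventually_conj)
        then obtain n where "norm (rad n) < 2 * \<epsilon> \<and> 1 \<le> n"
          using eventually_happens'[OF sequentially_bot] by blast
        then show ?thesis by (intro exI[of _ n]) auto
      qed
      then have n: "1 \<le> n" "rad n \<le> 2 * \<epsilon>"
        using LeastI_ex[of "\<lambda>n. 1 \<le> n \<and> rad n \<le> 2 * \<epsilon>", folded n_def] by auto
      have up: "\<epsilon> \<le> 2 * rad n"
      proof (cases "n = 1")
        case True
        then show ?thesis using \<epsilon> by (simp add: radius_def)
      next
        case False
        then have "\<not> rad (n - 1) \<le> 2 * \<epsilon>"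
          using not_less_Least[of "n - 1" "\<lambda>n. 1 \<le> n \<and> rad n \<le> 2 * \<epsilon>", folded n_def] n by auto
        moreover have "rad (n - 1) = 2 * rad n"
          using n by (cases n) (auto simp: radius_def)
        ultimately show ?thesis using \<epsilon> by simp
      qed
      have card: "2 \<le> card (S n)" "entropy_number T d (2 * \<epsilon>) \<le> card (S n)"
        using card_net_ge_2[OF False n(1)] entropy_number_le_card_net[OF n(2)] by auto
      have "outer_measure_of M (small_oscillation T d M g (proj_limit T d S) \<epsilon>)
          \<le> ennreal (q ^ (card (S n) - 1))"
        by (rule small_oscillation_le[OF q(3) up False])
      also have "q ^ (card (S n) - 1) = exp (real (card (S n) - 1) * ln q)"
        using q by (simp add: exp_of_nat_mult)
      also have "\<dots> \<le> exp (- \<gamma> * real (entropy_number T d (2 * \<epsilon>)))"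
      proof -
        have "real (entropy_number T d (2 * \<epsilon>)) / 2 \<le> real (card (S n) - 1)"
          using card by simp
        then have "real (card (S n) - 1) * ln q \<le> real (entropy_number T d (2 * \<epsilon>)) / 2 * ln q"
          using q by (intro mult_right_mono_neg) auto
        then show ?thesis by (simp add: \<gamma>_def mult_ac)
      qed
      finally show ?thesis by (simp add: ennreal_leI)
    qed
  qed
  moreover have "0 < \<gamma>" using q by (simp add: \<gamma>_def)
  ultimately show ?thesis by blast
qed

section \<open>The distance induced by the process\<close>

context ultrametric_nets
begin

lemma center_cong: "s \<in> T \<Longrightarrow> t \<in> T \<Longrightarrow> d s t \<le> rad n \<Longrightarrow> ctr n s = ctr n t"
  by (intro center_eqI) (auto intro: dist_le_trans[of s "ctr n t" t] simp: center_in center_in_T dist_center)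

text \<open>The supremum in \<open>diam\<close> is an upper bound only once the distances are known
  to be bounded. This follows from finiteness of \<open>S 0\<close>: a distance exceeds the one
  between the two centers by at most \<open>2 * rad 0\<close>.\<close>

lemma dist_le_diam:
  assumes "s \<in> T" "t \<in> T"
  shows "d s t \<le> diam T d"
proof -
  let ?C = "(\<lambda>(c, c'). d c c') ` (S 0 \<times> S 0)"
  have "d s t \<le> 2 * rad 0 + Max ?C" if "s \<in> T" "t \<in> T" for s t
  proof -
    let ?a = "ctr 0 s" and ?b = "ctr 0 t"
    have "d ?a ?b \<le> Max ?C"
      using that center_in finite_net by (intro Max_ge) auto
    moreover have "d s t \<le> d s ?a + d ?a ?b + d ?b t"
      using metric.triangle[of s ?a t] metric.triangle[of ?a ?b t] that center_in_T by fastforce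
    moreover have "d s ?a \<le> rad 0" "d ?b t \<le> rad 0"
      using dist_center that metric.commute[of ?b t] by auto
    ultimately show ?thesis by linarith
  qed
  then have "bdd_above ((\<lambda>(s, t). d s t) ` (T \<times> T))"
    by (auto intro!: bdd_aboveI[where M = "2 * rad 0 + Max ?C"])
  then show ?thesis
    unfolding diam_def using assms by (intro cSUP_upper2[where x = "(s, t)"]) auto
qed

text \<open>The separation level is at least 1 because \<open>rad 0\<close> is the diameter, so that
  all points share their center at level 0.\<close>

lemma first_difference:
  assumes "s \<in> T" "t \<in> T"
  obtains (same) "limit_embed T d S s = limit_embed T d S t"
  | (differ) m where "1 \<le> m" "ctr m s \<noteq> ctr m t" "\<And>k. k < m \<Longrightarrow> ctr k s = ctr k t"
proof (cases "\<exists>m. ctr m s \<noteq> ctr m t")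
  case True
  define m where "m = (LEAST m. ctr m s \<noteq> ctr m t)"
  have "ctr m s \<noteq> ctr m t" unfolding m_def using True by (rule LeastI_ex)
  moreover have "ctr k s = ctr k t" if "k < m" for k
    using not_less_Least[of k "\<lambda>m. ctr m s \<noteq> ctr m t"] that by (auto simp: m_def)
  moreover have "ctr 0 s = ctr 0 t"
    using center_cong[OF assms, of 0] dist_le_diam[OF assms] by (simp add: radius_def)
  ultimately show ?thesis using differ by (metis less_one not_le)
qed (auto simp: limit_embed_def fun_eq_iff intro: same)

end

context ultrametric_process
begin

lemma Z_measurable: "t \<in> T \<Longrightarrow> Z T d g (limit_embed T d S t) \<in> borel_measurable M"
  unfolding Z_def[abs_def] Z_term_embed
  using measurable_X[OF index_in] by (intro borel_measurable_suminf borel_measurable_times) auto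

text \<open>Terms below \<open>m\<close> cancel. From \<open>m\<close> on the two centers differ at
  every level, so the remaining variables are pairwise distinct and hence orthonormal in L2.\<close>

lemma increment_partial_second_moment:
  assumes st: "s \<in> T" "t \<in> T" and m: "ctr m s \<noteq> ctr m t" "\<And>k. k < m \<Longrightarrow> ctr k s = ctr k t"
  shows "(\<integral>\<omega>. (\<Sum>k<N. rad k * (g (k, ctr k s) \<omega> - g (k, ctr k t) \<omega>))\<^sup>2 \<partial>M)
    = (\<Sum>k\<in>{m..<N}. 2 * (rad k)\<^sup>2)"
proof -
  let ?K = "{m..<N}"
  let ?i = "\<lambda>k. (k, ctr k s)" and ?j = "\<lambda>k. (k, ctr k t)"
  \<comment> \<open>One coefficient function on the union of the two index families; its sign
    records the family.\<close>
  define c where "c i = (if i = ?i (fst i) then rad (fst i) else - rad (fst i))" for i :: "nat \<times> 'a"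
  have ne: "ctr k s \<noteq> ctr k t" if "m \<le> k" for k
    using center_eq_mono[OF st that] m(1) by blast
  have inj: "inj_on ?i A" "inj_on ?j A" for A by (auto simp: inj_on_def)
  have disj: "?i ` ?K \<inter> ?j ` ?K = {}" using ne by auto
  have split: "(\<Sum>x\<in>?i ` ?K \<union> ?j ` ?K. f x) = (\<Sum>k\<in>?K. f (?i k) + f (?j k))" for f :: "nat \<times> 'a \<Rightarrow> real"
    using disj inj by (simp add: sum.union_disjoint sum.reindex sum.distrib)
  have eq: "(\<Sum>k<N. rad k * (g (k, ctr k s) \<omega> - g (k, ctr k t) \<omega>))
      = (\<Sum>x\<in>?i ` ?K \<union> ?j ` ?K. c x * g x \<omega>)" for \<omega>
  proof -
    have "(\<Sum>k<N. rad k * (g (k, ctr k s) \<omega> - g (k, ctr k t) \<omega>))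
        = (\<Sum>k\<in>?K. rad k * (g (k, ctr k s) \<omega> - g (k, ctr k t) \<omega>))"
      using m(2) by (intro sum.mono_neutral_right) auto
    also have "\<dots> = (\<Sum>x\<in>?i ` ?K \<union> ?j ` ?K. c x * g x \<omega>)"
      unfolding split using ne ne[symmetric] by (intro sum.cong) (auto simp: c_def algebra_simps)
    finally show ?thesis .
  qed
  show ?thesis
    unfolding eq using st index_in
    by (subst second_moment) (auto simp: split c_def intro!: sum.cong)
qed

lemma rad_Suc: "rad (Suc n) = rad n / 2"
  by (simp add: radius_def)

text \<open>A geometric series of ratio 1/4: the factor is 2 / (1 - 1/4).\<close>

lemma sum_rad_square_limit: "(\<lambda>N. \<Sum>k\<in>{m..<N}. 2 * (rad k)\<^sup>2) \<longlonglongrightarrow> 8 / 3 * (rad m)\<^sup>2"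
proof -
  have "(\<Sum>k\<in>{m..<m + j}. 2 * (rad k)\<^sup>2) = 8 / 3 * ((rad m)\<^sup>2 - (rad (m + j))\<^sup>2)" for j
    by (induction j) (simp_all add: rad_Suc power_divide)
  then have "(\<lambda>j. \<Sum>k\<in>{m..<m + j}. 2 * (rad k)\<^sup>2) = (\<lambda>j. 8 / 3 * ((rad m)\<^sup>2 - (rad (j + m))\<^sup>2))"
    by (simp only: add.commute)
  moreover have "(\<lambda>j. rad (j + m)) \<longlonglongrightarrow> 0"
    using summable_LIMSEQ_zero[OF summable_rad] by (rule LIMSEQ_ignore_initial_segment)
  then have "(\<lambda>j. 8 / 3 * ((rad m)\<^sup>2 - (rad (j + m))\<^sup>2)) \<longlonglongrightarrow> 8 / 3 * ((rad m)\<^sup>2 - 0\<^sup>2)"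
    by (intro tendsto_intros)
  ultimately have "(\<lambda>j. \<Sum>k\<in>{m..<j + m}. 2 * (rad k)\<^sup>2) \<longlonglongrightarrow> 8 / 3 * (rad m)\<^sup>2"
    by (simp add: add.commute)
  then show ?thesis by (rule LIMSEQ_offset)
qed

text \<open>The second moments of the partial sums are known exactly, and
  \<open>weighted_series_L2\<close> passes to the limit under the expectation. Subtracting the two
  series termwise is legitimate almost surely, which is enough for the integral.\<close>

lemma Z_dist_eq:
  assumes st: "s \<in> T" "t \<in> T" and m: "ctr m s \<noteq> ctr m t" "\<And>k. k < m \<Longrightarrow> ctr k s = ctr k t"
  shows "Z_dist T d S M g s t = sqrt (8 / 3) * rad m"
proof -
  define Y where "Y k \<omega> = g (k, ctr k s) \<omega> - g (k, ctr k t) \<omega>" for k \<omega>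
  note I = index_in[OF st(1)] index_in[OF st(2)]
  have Y_sq: "(Y k \<omega>)\<^sup>2 = g (k, ctr k s) \<omega> * g (k, ctr k s) \<omega>
      + g (k, ctr k t) \<omega> * g (k, ctr k t) \<omega> - 2 * (g (k, ctr k s) \<omega> * g (k, ctr k t) \<omega>)" for k \<omega>
    by (simp add: Y_def power2_eq_square algebra_simps)
  have "(\<lambda>N. \<integral>\<omega>. (\<Sum>k<N. rad k * Y k \<omega>)\<^sup>2 \<partial>M) \<longlonglongrightarrow> (\<integral>\<omega>. (\<Sum>k. rad k * Y k \<omega>)\<^sup>2 \<partial>M)"
  proof (rule weighted_series_L2(2)[where K = 2])
    show "Y k \<in> borel_measurable M" for k
      unfolding Y_def[abs_def] using measurable_X I by (intro borel_measurable_diff) auto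
    show "integrable M (\<lambda>\<omega>. (Y k \<omega>)\<^sup>2)" for k
      unfolding Y_sq
      by (intro Bochner_Integration.integrable_diff Bochner_Integration.integrable_add
          integrable_mult_right integrable_mult_X I)
    show "(\<integral>\<omega>. (Y k \<omega>)\<^sup>2 \<partial>M) \<le> 2" for k
      unfolding Y_sq using I by (simp add: integrable_mult_X integral_mult_X)
  qed (use rad_nonneg summable_rad in auto)
  moreover have "(\<integral>\<omega>. (\<Sum>k<N. rad k * Y k \<omega>)\<^sup>2 \<partial>M) = (\<Sum>k\<in>{m..<N}. 2 * (rad k)\<^sup>2)" for N
    unfolding Y_def by (rule increment_partial_second_moment[OF st m])
  then have "(\<lambda>N. \<integral>\<omega>. (\<Sum>k<N. rad k * Y k \<omega>)\<^sup>2 \<partial>M) \<longlonglongrightarrow> 8 / 3 * (rad m)\<^sup>2"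
    using sum_rad_square_limit by simp
  ultimately have lim: "(\<integral>\<omega>. (\<Sum>k. rad k * Y k \<omega>)\<^sup>2 \<partial>M) = 8 / 3 * (rad m)\<^sup>2"
    by (rule LIMSEQ_unique)
  have "(\<integral>\<omega>. (Z T d g (limit_embed T d S s) \<omega> - Z T d g (limit_embed T d S t) \<omega>)\<^sup>2 \<partial>M)
      = (\<integral>\<omega>. (\<Sum>k. rad k * Y k \<omega>)\<^sup>2 \<partial>M)"
  proof (rule integral_cong_AE)
    show "AE \<omega> in M. (Z T d g (limit_embed T d S s) \<omega> - Z T d g (limit_embed T d S t) \<omega>)\<^sup>2
        = (\<Sum>k. rad k * Y k \<omega>)\<^sup>2"
      using AE_summable[OF st(1)] AE_summable[OF st(2)]
    proof eventually_elim
      case (elim \<omega>)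
      then show ?case
        unfolding Z_def Y_def by (simp add: suminf_diff Z_term_embed[abs_def] right_diff_distrib)
    qed
    have [measurable]: "Y k \<in> borel_measurable M" for k
      unfolding Y_def[abs_def] using measurable_X I by (intro borel_measurable_diff) auto
    show "(\<lambda>\<omega>. (\<Sum>k. rad k * Y k \<omega>)\<^sup>2) \<in> borel_measurable M" by measurable
  qed (use Z_measurable st in \<open>auto intro!: borel_measurable_power borel_measurable_diff\<close>)
  then show ?thesis
    unfolding Z_dist_def lim using rad_nonneg[of m] by (simp add: real_sqrt_mult del: times_divide_eq_left)
qed

lemma Z_dist_le:
  assumes "s \<in> T" "t \<in> T"
  shows "Z_dist T d S M g s t \<le> sqrt (8 / 3) * rad 1"
  using assms
proof (cases rule: first_difference)
  case same
  then show ?thesis using rad_nonneg by (simp add: Z_dist_def)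
next
  case (differ m)
  then show ?thesis
    using Z_dist_eq[OF assms differ(2,3)] rad_antimono[OF differ(1)] by simp
qed

text \<open>Attained at two points of \<open>S 1\<close>: they share their center at level 0 and are
  separated at level 1.\<close>

lemma diam_Z_dist:
  assumes "T \<noteq> {}"
  shows "diam T (Z_dist T d S M g) = sqrt (8 / 3) * rad 1"
proof -
  have "2 \<le> card (S 1)" using card_net_ge_2 assms by blast
  then obtain s t where st: "s \<in> S 1" "t \<in> S 1" "s \<noteq> t"
    using card_le_Suc0_iff_eq[OF finite_net, of 1] by force
  then have stT: "s \<in> T" "t \<in> T" using net_subset by blast+
  have "ctr 0 s = ctr 0 t"
    using center_cong[OF stT, of 0] dist_le_diam[OF stT] by (simp add: radius_def)
  then have eq: "Z_dist T d S M g s t = sqrt (8 / 3) * rad 1"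
    using st center_net[OF st(1)] center_net[OF st(2)]
    by (intro Z_dist_eq[OF stT]) auto
  have bdd: "bdd_above ((\<lambda>(s, t). Z_dist T d S M g s t) ` (T \<times> T))"
    using Z_dist_le by (auto intro!: bdd_aboveI)
  show ?thesis
  proof (rule antisym)
    show "diam T (Z_dist T d S M g) \<le> sqrt (8 / 3) * rad 1"
      unfolding diam_def using assms Z_dist_le by (intro cSUP_least) auto
    show "sqrt (8 / 3) * rad 1 \<le> diam T (Z_dist T d S M g)"
      unfolding diam_def using bdd stT eq by (intro cSUP_upper2[where x = "(s, t)"]) auto
  qed
qed

text \<open>The diameter belongs to separation level 1, so dividing it by \<open>2 ^ n\<close> gives
  the distance of pairs separated at level \<open>n + 1\<close>. Pairs at most that far apart share
  their centers up to and including level \<open>n\<close>.\<close>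

lemma center_eq_of_Z_dist_le:
  assumes st: "s \<in> T" "t \<in> T"
    and le: "Z_dist T d S M g s t \<le> diam T (Z_dist T d S M g) / 2 ^ n"
  shows "ctr n s = ctr n t"
  using st
proof (cases rule: first_difference)
  case same
  then show ?thesis by (simp add: limit_embed_def fun_eq_iff)
next
  case (differ m)
  have "n < m"
  proof (rule ccontr)
    assume "\<not> n < m"
    then have "rad n \<le> rad m" by (intro rad_antimono) simp
    moreover have "diam T (Z_dist T d S M g) / 2 ^ n = sqrt (8 / 3) * (rad n / 2)"
      using st by (subst diam_Z_dist) (auto simp: radius_def)
    then have "sqrt (8 / 3) * rad m \<le> sqrt (8 / 3) * (rad n / 2)"
      using le Z_dist_eq[OF st differ(2,3)] by linarith
    then have "rad m \<le> rad n / 2" by simp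
    ultimately show False using rad_pos[of n] by linarith
  qed
  then show ?thesis using differ by blast
qed

end

section \<open>Small balls for the partial sums\<close>

context ultrametric_process
begin

text \<open>Although the levels up to \<open>n\<close> may hold many more variables than
  \<open>S n\<close> has points, the cost is 1/2 per point of \<open>S n\<close>: a variable of
  level \<open>j\<close> exceeds its threshold with probability at most
  \<open>(1 / 2) ^ (j + 2)\<close>, each level has at most \<open>card (S n)\<close> variables, and
  the product over the levels of the success probabilities is at least 1/2. Thresholds growing
  linearly remain summable against \<open>rad j\<close>.\<close>

lemma box_probability:
  "(1 / 2) ^ card (S n) \<le> measure (PiM (Sigma {..n} S) (\<lambda>_. std_normal))
    (\<Pi>\<^sub>E (j, u)\<in>Sigma {..n} S. {x. \<bar>x\<bar> \<le> real j + 3})"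
proof -
  interpret N: prob_space std_normal by (rule prob_space_std_normal)
  have fin: "finite (Sigma {..n} S)" using finite_net by auto
  then interpret P: finite_product_prob_space "\<lambda>_. std_normal" "Sigma {..n} S"
    by unfold_locales
  define p where "p j = measure std_normal {x. \<bar>x\<bar> \<le> real j + 3}" for j
  have p: "1 - (1 / 2) ^ (j + 2) \<le> p j" for j
  proof -
    have "1 - p j = measure std_normal (space std_normal - {x. \<bar>x\<bar> \<le> real j + 3})"
      unfolding p_def by (subst N.prob_compl) auto
    also have "\<dots> \<le> measure std_normal ({real j + 3<..} \<union> {..<- (real j + 3)})"
      by (intro N.finite_measure_mono) auto
    also have "\<dots> \<le> measure std_normal {real j + 3<..} + measure std_normal {..<- (real j + 3)}"
      by (rule measure_Un_le) auto
    also have "\<dots> \<le> 2 * exp (- (real j + 3)\<^sup>2 / 2)"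
      using std_normal_tail[of "real j + 3"] by simp
    \<comment> \<open>As \<open>(real j + 3) / 2\<close> exceeds \<open>ln 2\<close>, the Gaussian
      exponent beats the geometric one.\<close>
    also have "\<dots> \<le> 2 * exp (real (j + 3) * - ln 2)"
    proof -
      have "(real j + 3) * ln 2 \<le> (real j + 3) * ((real j + 3) / 2)"
        using ln_2_less_1 by (intro mult_left_mono) auto
      then show ?thesis by (simp add: power2_eq_square field_simps)
    qed
    also have "\<dots> = (1 / 2) ^ (j + 2)"
    proof -
      have "exp (real (j + 3) * - ln (2 :: real)) = (1 / 2) ^ (j + 3)"
        by (subst exp_of_nat_mult) (simp add: exp_minus inverse_eq_divide power_one_over)
      then show ?thesis by (simp add: eval_nat_numeral)
    qed
    finally show ?thesis by simp
  qed
  have half: "1 - (1 / 2 :: real) ^ (j + 2) \<ge> 0" for j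
    using power_le_one[of "1/2::real" "j + 2"] by simp
  have "measure (PiM (Sigma {..n} S) (\<lambda>_. std_normal)) (\<Pi>\<^sub>E (j, u)\<in>Sigma {..n} S. {x. \<bar>x\<bar> \<le> real j + 3})
      = (\<Prod>i\<in>Sigma {..n} S. p (fst i))"
    unfolding p_def case_prod_beta by (rule P.prob_times) auto
  also have "\<dots> = (\<Prod>j\<le>n. p j ^ card (S j))"
    using prod.Sigma[of "{..n}" S "\<lambda>j _. p j"] finite_net by (simp add: case_prod_beta)
  also have "(1 / 2) ^ card (S n) \<le> (\<Prod>j\<le>n. p j ^ card (S j))"
  proof -
    have "1 / 2 \<le> (\<Prod>j\<le>n. 1 - (1 / 2 :: real) ^ (j + 2))"
    proof -
      have "(\<Sum>j\<le>n. (1 / 2 :: real) ^ (j + 2)) = 1 / 2 - (1 / 2) ^ (n + 2)"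
        by (induction n) (simp_all add: field_simps)
      then have "1 / 2 \<le> 1 - (\<Sum>j\<le>n. (1 / 2 :: real) ^ (j + 2))" by simp
      also have "\<dots> \<le> (\<Prod>j\<le>n. 1 - (1 / 2 :: real) ^ (j + 2))"
        using half by (intro Weierstrass_prod_ineq) auto
      finally show ?thesis .
    qed
    then have "(1 / 2) ^ card (S n) \<le> (\<Prod>j\<le>n. 1 - (1 / 2 :: real) ^ (j + 2)) ^ card (S n)"
      by (intro power_mono) auto
    also have "\<dots> = (\<Prod>j\<le>n. (1 - (1 / 2 :: real) ^ (j + 2)) ^ card (S n))"
      by (rule prod_power_distrib)
    also have "\<dots> \<le> (\<Prod>j\<le>n. p j ^ card (S j))"
    proof (intro prod_mono conjI)
      fix j assume "j \<in> {..n}"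
      then have "card (S j) \<le> card (S n)" using card_net_mono by simp
      then have "(1 - (1 / 2 :: real) ^ (j + 2)) ^ card (S n) \<le> (1 - (1 / 2) ^ (j + 2)) ^ card (S j)"
        using half by (intro power_decreasing) auto
      also have "\<dots> \<le> p j ^ card (S j)" using p half by (intro power_mono) auto
      finally show "(1 - (1 / 2 :: real) ^ (j + 2)) ^ card (S n) \<le> p j ^ card (S j)" .
      show "0 \<le> (1 - (1 / 2 :: real) ^ (j + 2)) ^ card (S n)" using half by (intro zero_le_power)
    qed
    finally show ?thesis .
  qed
  finally show ?thesis .
qed

text \<open>The Gaussian variables at a fixed level \<open>k\<close> cost a constant factor only. Relative to a
  representative with the same level-\<open>k\<close> ancestor, all other points have fluctuations of
  order \<open>A'\<close>, and choosing \<open>A'\<close> small beats every constant per point.\<close>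

lemma center_small_ball:
  assumes "T \<noteq> {}"
  obtains r k where "0 < r"
    "\<And>n \<epsilon>. k \<le> n \<Longrightarrow> 0 < \<epsilon> \<Longrightarrow> \<epsilon> \<le> 1 / 16 \<Longrightarrow>
      r * \<epsilon> ^ card (S n) \<le> prob {\<omega> \<in> space M. \<forall>u\<in>S n.
        \<bar>\<Sum>j\<le>n. rad j * g (j, ctr j u) \<omega>\<bar> \<le> \<epsilon> * (2 * diam T d / sqrt 3) / 4}"
proof -
  define \<sigma> where "\<sigma> = 2 * diam T d / sqrt 3"
  have \<sigma>: "0 < \<sigma>" using diam_pos by (simp add: \<sigma>_def)
  \<comment> \<open>Bounds the term of level \<open>j\<close> on the box of
    \<open>box_probability\<close>.\<close>
  define h where "h j = rad j * (real j + 3)" for j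
  have h0: "0 \<le> h j" for j using rad_nonneg by (simp add: h_def)
  have h: "summable h"
  proof -
    have "summable (\<lambda>j. (real j + 3) * (1 / 2 :: real) ^ j)"
    proof -
      have "summable (\<lambda>j. of_nat (Suc j) * (1 / 2 :: real) ^ j + 2 * (1 / 2) ^ j)"
        using geometric_deriv_sums[of "1 / 2 :: real"] summable_geometric[of "1 / 2 :: real"]
        by (intro summable_add summable_mult) (auto simp: sums_iff)
      then show ?thesis by (simp add: algebra_simps)
    qed
    then have "summable (\<lambda>j. diam T d * ((real j + 3) * (1 / 2) ^ j))" by (rule summable_mult)
    then show ?thesis by (simp add: h_def[abs_def] radius_def power_divide mult_ac)
  qed
  \<comment> \<open>Chosen so that \<open>w / (4 * A') = 4 * \<epsilon>\<close> for the mesh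
    \<open>w\<close> below; this 4 compensates the factor 1/4 per point from the squared probability
    of the box.\<close>
  define A' where "A' = sqrt 2 * \<sigma> / 128"
  have A': "0 < A'" using \<sigma> by (simp add: A'_def)
  \<comment> \<open>Half of \<open>A'\<close>, since a point and its representative both contribute
    their terms above level \<open>k\<close>.\<close>
  obtain k0 where "\<And>n. k0 \<le> n \<Longrightarrow> norm (\<Sum>i. h (i + n)) < A' / 2"
    using suminf_exist_split[OF _ h, of "A' / 2"] A' by auto
  then obtain k where k: "(\<Sum>i. h (i + Suc k)) \<le> A' / 2"
    by (metis abs_le_D1 le_SucI less_imp_le order_refl real_norm_def)
  \<comment> \<open>Representatives only get the crude bound by the whole series, and
    \<open>r\<close> is the price of one of them relative to an ordinary point. There are at most
    \<open>card (S k)\<close> of them, whatever \<open>n\<close> is.\<close>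
  define A0 where "A0 = max A' (suminf h)"
  define r where "r = A' / A0"
  have A0: "A' \<le> A0" "suminf h \<le> A0" "0 < A0" using A' by (auto simp: A0_def)
  have r: "0 < r" "r \<le> 1" using A0 A' by (auto simp: r_def)
  show ?thesis
  proof
    show "0 < r ^ card (S k)" using r by simp
    fix n and \<epsilon> :: real assume kn: "k \<le> n" and \<epsilon>: "0 < \<epsilon>" "\<epsilon> \<le> 1 / 16"
    let ?I = "Sigma {..n} S"
    let ?P = "PiM ?I (\<lambda>_. borel :: real measure)" and ?Q = "PiM ?I (\<lambda>_. std_normal)"
    define V where "V u f = (\<Sum>j\<le>n. rad j * f (j, ctr j u))" for u and f :: "nat \<times> 'a \<Rightarrow> real"
    define rep where "rep u = ctr n (ctr k u)" for u
    define reps where "reps = ctr n ` S k"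
    \<comment> \<open>\<open>V u\<close> is a sum of at most two of these forms, its own and that of
      its representative; hence the mesh \<open>w\<close> allows each of them only
      \<open>\<epsilon> * \<sigma> / 8\<close>.\<close>
    define L where "L u f = V u f - (if u \<in> reps then 0 else V (rep u) f)" for u f
    define A where "A u = (if u \<in> reps then A0 else A')" for u
    define w where "w = sqrt 2 * \<epsilon> * \<sigma> / 8"
    define B where "B = (\<Pi>\<^sub>E (j, u)\<in>?I. {x :: real. \<bar>x\<bar> \<le> real j + 3})"
    have in_I: "(j, ctr j u) \<in> ?I" if "j \<le> n" "u \<in> T" for j u
      using that center_in by auto
    have I_ne: "?I \<noteq> {}" using assms in_I by blast
    have fin: "finite ?I" using finite_net by auto
    have rep: "rep u \<in> S n" "rep u \<in> reps" "rep u \<in> T" if "u \<in> T" for u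
      using that center_in center_in_T by (auto simp: rep_def reps_def)
    have V_meas: "V u \<in> borel_measurable ?P" if "u \<in> T" for u
      unfolding V_def[abs_def] using in_I[OF _ that]
      by (intro borel_measurable_sum borel_measurable_times borel_measurable_const
          measurable_component_singleton) auto
    have L_meas: "L u \<in> borel_measurable ?P" if "u \<in> S n" for u
      unfolding L_def[abs_def] using V_meas rep that net_subset by (cases "u \<in> reps") auto
    have E_sets: "{x \<in> space ?P. \<forall>u\<in>S n. \<bar>V u x\<bar> \<le> \<epsilon> * \<sigma> / 4} \<in> sets ?P"
    proof (intro sets.sets_Collect_finite_All finite_net)
      fix u assume "u \<in> S n"
      note [measurable] = V_meas[OF net_subset[OF this]]
      show "{x \<in> space ?P. \<bar>V u x\<bar> \<le> \<epsilon> * \<sigma> / 4} \<in> sets ?P" by measurable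
    qed
    have setsQ: "sets ?Q = sets ?P" by (intro sets_PiM_cong) auto
    then have spaceQ: "space ?Q = space ?P" by (rule sets_eq_imp_space_eq)
    interpret Q: prob_space ?Q by (intro prob_space_PiM prob_space_std_normal)
    have V_lin: "V u (\<lambda>i\<in>?I. (x i - y i) / sqrt 2) = (V u (restrict x ?I) - V u (restrict y ?I)) / sqrt 2"
      if "u \<in> T" for u x y
    proof -
      have "V u (\<lambda>i\<in>?I. (x i - y i) / sqrt 2)
          = (\<Sum>j\<le>n. (rad j * restrict x ?I (j, ctr j u) - rad j * restrict y ?I (j, ctr j u)) / sqrt 2)"
        unfolding V_def using in_I[OF _ that] by (intro sum.cong) (auto simp: field_simps)
      then show ?thesis by (simp add: V_def sum_divide_distrib[symmetric] sum_subtractf)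
    qed
    have B_sets: "B \<in> sets ?P"
      unfolding B_def case_prod_beta using fin by (intro sets_PiM_I_finite) auto
    have B_bound: "\<bar>rad j * f (j, ctr j u)\<bar> \<le> h j" if "f \<in> B" "j \<le> n" "u \<in> T" for f j u
    proof -
      have "\<bar>f (j, ctr j u)\<bar> \<le> real j + 3"
        using PiE_mem[OF that(1)[unfolded B_def] in_I[OF that(2,3)]] by simp
      then show ?thesis using rad_nonneg by (simp add: h_def abs_mult mult_left_mono)
    qed
    have bound: "\<bar>L u f\<bar> \<le> A u" if u: "u \<in> S n" and f: "f \<in> B" for u f
    proof (cases "u \<in> reps")
      case True
      have "\<bar>L u f\<bar> \<le> (\<Sum>j\<le>n. \<bar>rad j * f (j, ctr j u)\<bar>)"
        using True by (simp add: L_def V_def)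
      also have "\<dots> \<le> (\<Sum>j\<le>n. h j)"
        using B_bound[OF f _ net_subset[OF u]] by (intro sum_mono) auto
      also have "\<dots> \<le> suminf h" using h h0 by (intro sum_le_suminf) auto
      finally show ?thesis using True A0 by (simp add: A_def)
    next
      case False
      have uT: "u \<in> T" using net_subset[OF u] .
      have same: "ctr j (rep u) = ctr j u" if "j \<le> k" for j
        using that kn uT center_in_T[OF uT]
        by (simp add: rep_def center_center)
      have "L u f = (\<Sum>j\<le>n. rad j * f (j, ctr j u) - rad j * f (j, ctr j (rep u)))"
        using False by (simp add: L_def V_def sum_subtractf)
      also have "\<dots> = (\<Sum>j\<in>{Suc k..n}. rad j * f (j, ctr j u) - rad j * f (j, ctr j (rep u)))"
        using same by (intro sum.mono_neutral_right) auto
      finally have "\<bar>L u f\<bar> \<le> (\<Sum>j\<in>{Suc k..n}. \<bar>rad j * f (j, ctr j u) - rad j * f (j, ctr j (rep u))\<bar>)"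
        by simp
      also have "\<dots> \<le> (\<Sum>j\<in>{Suc k..n}. 2 * h j)"
      proof (rule sum_mono)
        fix j assume "j \<in> {Suc k..n}"
        then have "\<bar>rad j * f (j, ctr j u)\<bar> \<le> h j" "\<bar>rad j * f (j, ctr j (rep u))\<bar> \<le> h j"
          using B_bound[OF f _ uT] B_bound[OF f _ rep(3)[OF uT]] by auto
        then show "\<bar>rad j * f (j, ctr j u) - rad j * f (j, ctr j (rep u))\<bar> \<le> 2 * h j" by linarith
      qed
      also have "\<dots> = 2 * (\<Sum>i<n - k. h (i + Suc k))"
      proof -
        have "(\<Sum>j\<in>{Suc k..n}. h j) = (\<Sum>i<n - k. h (i + Suc k))"
          using kn by (intro sum.reindex_bij_witness[of _ "\<lambda>i. i + Suc k" "\<lambda>j. j - Suc k"]) auto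
        then show ?thesis by (simp only: sum_distrib_left[symmetric])
      qed
      also have "\<dots> \<le> 2 * (\<Sum>i. h (i + Suc k))"
        using h h0 by (intro mult_left_mono sum_le_suminf) (auto simp only: summable_iff_shift finite_lessThan)
      also have "\<dots> \<le> A'" using k by simp
      finally show ?thesis using False by (simp add: A_def)
    qed
    \<comment> \<open>The bound \<open>w \<le> A'\<close> is the place where
      \<open>\<epsilon> \<le> 1 / 16\<close> enters.\<close>
    have w: "0 < w" "w \<le> A'" "w / (4 * A') = 4 * \<epsilon>" "w / sqrt 2 = \<epsilon> * \<sigma> / 8"
      using \<epsilon> \<sigma> by (auto simp: w_def A'_def field_simps)
    have "(measure ?Q B)\<^sup>2 * (\<Prod>u\<in>S n. w / (4 * A u))
        \<le> measure ?Q {x \<in> space ?Q. \<forall>u\<in>S n. \<bar>L u x\<bar> \<le> w / sqrt 2}"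
    proof (rule gaussian_pigeonhole[OF I_ne finite_net L_meas _ B_sets bound w(1)])
      show "L u (\<lambda>i\<in>?I. (x i - y i) / sqrt 2) = (L u (restrict x ?I) - L u (restrict y ?I)) / sqrt 2"
        if "u \<in> S n" for u x y
        using V_lin[OF net_subset[OF that]] V_lin[OF rep(3)[OF net_subset[OF that]]]
        by (auto simp: L_def diff_divide_distrib)
      show "w \<le> A u" for u using w A0 by (simp add: A_def)
    qed
    moreover have "r ^ card (S k) * \<epsilon> ^ card (S n) \<le> (measure ?Q B)\<^sup>2 * (\<Prod>u\<in>S n. w / (4 * A u))"
    proof -
      have reps: "reps \<subseteq> S n" "card reps \<le> card (S k)"
        using center_in net_subset finite_net by (auto simp: reps_def card_image_le)
      have "(\<Prod>u\<in>S n. w / (4 * A u)) = (\<Prod>u\<in>S n. 4 * \<epsilon> * (if u \<in> reps then r else 1))"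
        using w(3) A' A0(3) by (intro prod.cong) (auto simp: A_def r_def field_simps)
      also have "\<dots> = (4 * \<epsilon>) ^ card (S n) * r ^ card reps"
        using reps(1) finite_net by (simp add: prod.distrib prod.If_cases Int_absorb1)
      finally have "(4 * \<epsilon>) ^ card (S n) * r ^ card (S k) \<le> (\<Prod>u\<in>S n. w / (4 * A u))"
        using r \<epsilon> reps(2) by (simp add: mult_left_mono power_decreasing)
      moreover have "(1 / 4) ^ card (S n) \<le> (measure ?Q B)\<^sup>2"
      proof -
        have "((1 / 2) ^ card (S n))\<^sup>2 \<le> (measure ?Q B)\<^sup>2"
          unfolding B_def by (intro power_mono box_probability) auto
        also have "((1 / 2 :: real) ^ card (S n))\<^sup>2 = (1 / 4) ^ card (S n)"
          unfolding power2_eq_square power_mult_distrib[symmetric] by simp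
        finally show ?thesis .
      qed
      ultimately have "(1 / 4) ^ card (S n) * ((4 * \<epsilon>) ^ card (S n) * r ^ card (S k))
          \<le> (measure ?Q B)\<^sup>2 * (\<Prod>u\<in>S n. w / (4 * A u))"
        using r \<epsilon> by (intro mult_mono) auto
      moreover have "(1 / 4) ^ card (S n) * ((4 * \<epsilon>) ^ card (S n) * r ^ card (S k))
          = r ^ card (S k) * \<epsilon> ^ card (S n)"
        by (simp add: power_mult_distrib power_divide)
      ultimately show ?thesis by linarith
    qed
    moreover have "measure ?Q {x \<in> space ?Q. \<forall>u\<in>S n. \<bar>L u x\<bar> \<le> w / sqrt 2}
        \<le> measure ?Q {x \<in> space ?P. \<forall>u\<in>S n. \<bar>V u x\<bar> \<le> \<epsilon> * \<sigma> / 4}"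
    proof (intro Q.finite_measure_mono subsetI)
      fix x assume x: "x \<in> {x \<in> space ?Q. \<forall>u\<in>S n. \<bar>L u x\<bar> \<le> w / sqrt 2}"
      then have L_le: "\<bar>L u x\<bar> \<le> \<epsilon> * \<sigma> / 8" if "u \<in> S n" for u
        using that unfolding w(4) by simp
      have "0 < \<epsilon> * \<sigma>" using \<epsilon> \<sigma> by simp
      have "\<bar>V u x\<bar> \<le> \<epsilon> * \<sigma> / 4" if u: "u \<in> S n" for u
      proof (cases "u \<in> reps")
        case True
        then have "L u x = V u x" by (simp add: L_def)
        then show ?thesis using L_le[OF u] \<open>0 < \<epsilon> * \<sigma>\<close> by linarith
      next
        case False
        note rep_u = rep(1,2)[OF net_subset[OF u]]
        have "\<bar>V u x - V (rep u) x\<bar> \<le> \<epsilon> * \<sigma> / 8" "\<bar>V (rep u) x\<bar> \<le> \<epsilon> * \<sigma> / 8"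
          using L_le[OF u] L_le[OF rep_u(1)] rep_u(2) False by (simp_all add: L_def)
        then show ?thesis by linarith
      qed
      then show "x \<in> {x \<in> space ?P. \<forall>u\<in>S n. \<bar>V u x\<bar> \<le> \<epsilon> * \<sigma> / 4}"
        using x spaceQ by auto
    qed (use setsQ E_sets in auto)
    moreover have "prob {\<omega> \<in> space M. \<forall>u\<in>S n. \<bar>\<Sum>j\<le>n. rad j * g (j, ctr j u) \<omega>\<bar> \<le> \<epsilon> * \<sigma> / 4}
        = measure ?Q {x \<in> space ?P. \<forall>u\<in>S n. \<bar>V u x\<bar> \<le> \<epsilon> * \<sigma> / 4}"
    proof -
      have "V u (\<lambda>i\<in>?I. g i \<omega>) = (\<Sum>j\<le>n. rad j * g (j, ctr j u) \<omega>)" if "u \<in> S n" for u \<omega>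
        unfolding V_def using in_I[OF _ net_subset[OF that]] by (intro sum.cong) auto
      then have "(\<lambda>i\<in>?I. g i \<omega>) \<in> {x \<in> space ?P. \<forall>u\<in>S n. \<bar>V u x\<bar> \<le> \<epsilon> * \<sigma> / 4}
          \<longleftrightarrow> (\<forall>u\<in>S n. \<bar>\<Sum>j\<le>n. rad j * g (j, ctr j u) \<omega>\<bar> \<le> \<epsilon> * \<sigma> / 4)" for \<omega>
        by (auto simp: space_PiM)
      then show ?thesis
        using prob_restrict[OF _ I_ne E_sets] by auto
    qed
    ultimately show "r ^ card (S k) * \<epsilon> ^ card (S n) \<le> prob {\<omega> \<in> space M. \<forall>u\<in>S n.
        \<bar>\<Sum>j\<le>n. rad j * g (j, ctr j u) \<omega>\<bar> \<le> \<epsilon> * (2 * diam T d / sqrt 3) / 4}"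
      unfolding \<sigma>_def by linarith
  qed
qed

end

section \<open>The lower bound\<close>

locale majorized_process = ultrametric_process T d S M g + \<mu>: prob_space \<mu>
  for T :: "'a set" and d S and M :: "'b measure" and g and \<mu> :: "'a measure" +
  fixes P :: "nat \<Rightarrow> 'a set set" and v :: "nat \<Rightarrow> real"
  assumes partitions: "admissible_partitions T d (Z_dist T d S M g) P"
    and space_\<mu>: "space \<mu> = T" and sets_\<mu>: "sets \<mu> = borel_sets_on T d"
    and log_tail_lim: "log_tail T P \<mu> 1 (\<lambda>_. 1) \<longlonglongrightarrow> 0"
    and v_pos: "\<And>m. 0 < v m" and v_sum: "summable (\<lambda>m. 1 / v m)"
begin

section \<open>Cells, their masses and their ancestors\<close>

abbreviation "DZ \<equiv> diam T (Z_dist T d S M g)"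
abbreviation "H \<equiv> log_tail T P \<mu> DZ v"
abbreviation "mass m t \<equiv> measure \<mu> (cell (P m) t)"

definition level_term :: "real \<Rightarrow> (nat \<Rightarrow> real) \<Rightarrow> nat \<Rightarrow> 'a \<Rightarrow> ennreal" where
  "level_term c w m t = ennreal (c / 2 ^ m) * sqrt_log (w m) (mass m t)"

lemma log_tail_eq: "log_tail T P \<mu> c w n = (SUP t\<in>T. \<Sum>j. level_term c w (n + 1 + j) t)"
  by (simp add: log_tail_def level_term_def Let_def)

lemma T_ne: "T \<noteq> {}"
  using \<mu>.not_empty space_\<mu> by simp

lemma DZ_eq: "DZ = sqrt (8 / 3) * rad 1"
  by (rule diam_Z_dist[OF T_ne])

lemma DZ_pos: "0 < DZ"
  unfolding DZ_eq using rad_pos by simp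

lemma finite_P: "finite (P n)" and partition: "partition_on T (P n)"
  and refines_P: "refines T (P (Suc n)) (P n)"
  and P_dist: "A \<in> P n \<Longrightarrow> s \<in> A \<Longrightarrow> t \<in> A \<Longrightarrow> Z_dist T d S M g s t \<le> DZ / 2 ^ n"
  using partitions by (auto simp: admissible_partitions_def)

lemma P_sets: "A \<in> P n \<Longrightarrow> A \<in> sets \<mu>"
  using partitions sets_\<mu> by (auto simp: admissible_partitions_def)

lemma P_subset: "A \<in> P n \<Longrightarrow> A \<subseteq> T" and P_nonempty: "A \<in> P n \<Longrightarrow> A \<noteq> {}"
  using partition[of n] by (auto simp: partition_on_def)

lemma cell_eqI: "A \<in> P n \<Longrightarrow> t \<in> A \<Longrightarrow> cell (P n) t = A"
  using partition[of n] unfolding cell_def partition_on_def disjoint_def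
  by (intro the_equality) auto

lemma cell_in: "t \<in> T \<Longrightarrow> cell (P n) t \<in> P n" and mem_cell: "t \<in> T \<Longrightarrow> t \<in> cell (P n) t"
proof -
  assume "t \<in> T"
  then obtain A where A: "A \<in> P n" "t \<in> A" using partition[of n] by (auto simp: partition_on_def)
  with cell_eqI[OF A] show "cell (P n) t \<in> P n" "t \<in> cell (P n) t" by simp_all
qed

lemma cell_antimono:
  assumes t: "t \<in> T" and "m \<le> n"
  shows "cell (P n) t \<subseteq> cell (P m) t"
  using assms(2)
proof (induction n rule: dec_induct)
  case (step n)
  obtain Y where Y: "Y \<in> P n" "cell (P (Suc n)) t \<subseteq> Y"
    using refines_P[of n] cell_in[OF t, of "Suc n"] by (auto simp: refines_def)
  then have "cell (P n) t = Y" using mem_cell[OF t, of "Suc n"] by (intro cell_eqI) auto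
  then show ?case using Y step by auto
qed simp

lemma mass_le_1: "mass m t \<le> 1"
  by (rule \<mu>.prob_le_1)

lemma mass_antimono: "t \<in> T \<Longrightarrow> m \<le> n \<Longrightarrow> mass n t \<le> mass m t"
  using cell_antimono cell_in P_sets by (intro \<mu>.finite_measure_mono) auto

lemma sum_mass: "(\<Sum>A\<in>P n. measure \<mu> A) \<le> 1"
proof -
  have "(\<Sum>A\<in>P n. measure \<mu> A) = measure \<mu> (\<Union>A\<in>P n. A)"
    using finite_P P_sets partition[of n]
    by (intro \<mu>.finite_measure_finite_Union[symmetric])
      (auto simp: partition_on_def disjoint_family_on_def disjoint_def)
  then show ?thesis by simp
qed

lemma center_cong_cell: "A \<in> P n \<Longrightarrow> s \<in> A \<Longrightarrow> t \<in> A \<Longrightarrow> ctr n s = ctr n t"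
  by (intro center_eq_of_Z_dist_le P_dist) (auto dest: P_subset)

text \<open>The choice is immaterial for a cell \<open>A\<close> of \<open>P n\<close>, whose points
  share their center at level \<open>n\<close>. The variable with index \<open>(n, rep n A)\<close>
  is the only one of level \<open>n\<close> that the points of \<open>A\<close> see.\<close>

definition rep :: "nat \<Rightarrow> 'a set \<Rightarrow> 'a" where
  "rep n A = ctr n (SOME t. t \<in> A)"

lemma rep_eq: "A \<in> P n \<Longrightarrow> t \<in> A \<Longrightarrow> rep n A = ctr n t"
  unfolding rep_def by (rule center_cong_cell) (auto intro: someI)

lemma rep_in: "A \<in> P n \<Longrightarrow> rep n A \<in> S n"
  using rep_eq P_nonempty P_subset center_in by (metis all_not_in_conv subsetD)

text \<open>\<open>rep n\<close> maps \<open>P n\<close> onto \<open>S n\<close>. Thus for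
  \<open>\<epsilon> \<le> 1\<close> an estimate with exponent \<open>card (S n)\<close> implies the
  one with the number of cells.\<close>

lemma card_net_le_card_P: "card (S n) \<le> card (P n)"
proof (rule surj_card_le[OF finite_P])
  show "S n \<subseteq> rep n ` P n"
  proof
    fix u assume u: "u \<in> S n"
    then have "u \<in> T" by (rule net_subset)
    then have "rep n (cell (P n) u) = u"
      using rep_eq[OF cell_in mem_cell] center_net[OF u] by metis
    then show "u \<in> rep n ` P n" using cell_in[OF \<open>u \<in> T\<close>] by force
  qed
qed

section \<open>Tails of the majorizing series\<close>

lemma series_offset_le:
  fixes f :: "nat \<Rightarrow> ennreal"
  shows "(\<Sum>j. f (j + i)) \<le> suminf f"
  by (subst (2) suminf_offset[of _ i]) (auto intro: summableI)

lemma log_tail_antimono: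
  assumes "m \<le> n"
  shows "log_tail T P \<mu> c w n \<le> log_tail T P \<mu> c w m"
  unfolding log_tail_eq
proof (rule SUP_mono', goal_cases)
  case (1 t)
  show ?case
    using series_offset_le[of "\<lambda>j. level_term c w (m + 1 + j) t" "n - m"] assms
    by (simp add: add_ac)
qed

lemma level_sum_le_log_tail: "t \<in> T \<Longrightarrow> (\<Sum>j. level_term c w (n + 1 + j) t) \<le> log_tail T P \<mu> c w n"
  unfolding log_tail_eq by (rule SUP_upper)

lemma level_term_le_log_tail:
  assumes "t \<in> T" "n < m"
  shows "level_term c w m t \<le> log_tail T P \<mu> c w n"
proof -
  have "(\<Sum>j\<in>{m - n - 1}. level_term c w (n + 1 + j) t) \<le> (\<Sum>j. level_term c w (n + 1 + j) t)"
    by (intro sum_le_suminf summableI) auto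
  also have "\<dots> \<le> log_tail T P \<mu> c w n" by (rule level_sum_le_log_tail[OF assms(1)])
  finally show ?thesis using assms(2) by simp
qed

text \<open>A cell of mass zero makes its summand infinite. Levels up to \<open>n\<close> do not
  occur in \<open>H n\<close>; there the cell contains one of level \<open>Suc n\<close>, which has
  positive mass.\<close>

lemma mass_pos:
  assumes "H n < \<infinity>" "t \<in> T"
  shows "0 < mass m t"
proof -
  have "level_term DZ v (max m (Suc n)) t < \<infinity>"
    by (rule le_less_trans[OF level_term_le_log_tail[OF assms(2)] assms(1)]) simp
  then have "mass (max m (Suc n)) t \<noteq> 0"
    using DZ_pos by (auto simp: level_term_def sqrt_log_def ennreal_mult_top)
  then show ?thesis
    using mass_antimono[OF assms(2), of m "max m (Suc n)"] measure_nonneg[of \<mu>]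
    by (smt (verit) max.cobounded1)
qed

text \<open>The terms of the first \<open>n\<close> levels are bounded uniformly in \<open>t\<close>
  by sums over finitely many cells. Together with \<open>\<epsilon> * \<sigma> < H 0\<close> this
  keeps \<open>\<epsilon>\<close> in a bounded range.\<close>

lemma H_0_finite:
  assumes "H n < \<infinity>"
  shows "H 0 < \<infinity>"
proof -
  define K where "K m = (\<Sum>A\<in>P m. ennreal (DZ / 2 ^ m) * sqrt_log (v m) (measure \<mu> A))" for m
  have K: "K m < \<infinity>" for m
  proof -
    have "measure \<mu> A \<noteq> 0" if A: "A \<in> P m" for A
    proof -
      obtain t where t: "t \<in> A" using P_nonempty[OF A] by auto
      then have "cell (P m) t = A" "t \<in> T" using cell_eqI[OF A] P_subset[OF A] by auto
      then show ?thesis using mass_pos[OF assms, of t m] by simp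
    qed
    then show ?thesis
      using finite_P by (auto simp: K_def sqrt_log_def ennreal_mult_less_top)
  qed
  have "H 0 \<le> (\<Sum>j<n. K (1 + j)) + H n"
    unfolding log_tail_eq[of _ _ 0]
  proof (rule SUP_least)
    fix t assume t: "t \<in> T"
    have le: "level_term DZ v m t \<le> K m" for m
    proof -
      have "(\<Sum>A\<in>{cell (P m) t}. ennreal (DZ / 2 ^ m) * sqrt_log (v m) (measure \<mu> A)) \<le> K m"
        unfolding K_def using t finite_P cell_in by (intro sum_mono2) auto
      then show ?thesis by (simp add: level_term_def)
    qed
    have "(\<Sum>j. level_term DZ v (0 + 1 + j) t)
        = (\<Sum>j. level_term DZ v (n + 1 + j) t) + (\<Sum>j<n. level_term DZ v (1 + j) t)"
      by (subst suminf_offset[of _ n]) (auto simp: add_ac intro: summableI)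
    also have "\<dots> \<le> H n + (\<Sum>j<n. K (1 + j))"
      by (intro add_mono level_sum_le_log_tail t sum_mono le)
    finally show "(\<Sum>j. level_term DZ v (0 + 1 + j) t) \<le> (\<Sum>j<n. K (1 + j)) + H n"
      by (simp add: add.commute)
  qed
  also have "\<dots> < \<infinity>" using K assms by simp
  finally show ?thesis .
qed

text \<open>Subadditivity of the square root on ln x + ln (1/p); if ln x is negative, its own term
  is truncated to zero and monotonicity suffices.\<close>

lemma sqrt_log_le: "0 \<le> p \<Longrightarrow> p \<le> 1 \<Longrightarrow> 0 < x \<Longrightarrow> sqrt_log x p \<le> ennreal (sqrt (ln x)) + sqrt_log 1 p"
proof -
  assume p: "0 \<le> p" "p \<le> 1" and x: "0 < x"
  show ?thesis
  proof (cases "p = 0")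
    case False
    with p have l: "0 \<le> ln (1 / p)" "ln (x / p) = ln x + ln (1 / p)"
      using x by (auto simp: ln_div)
    have "sqrt (ln (x / p)) \<le> max 0 (sqrt (ln x)) + sqrt (ln (1 / p))"
    proof (cases "0 \<le> ln x")
      case True
      then show ?thesis using sqrt_add_le_add_sqrt[OF True l(1)] l by simp
    next
      case neg: False
      then have "ln (x / p) \<le> ln (1 / p)" using l by simp
      then show ?thesis using real_sqrt_le_mono[of "ln (x / p)" "ln (1 / p)"] neg by simp
    qed
    then have "ennreal (sqrt (ln (x / p))) \<le> ennreal (max 0 (sqrt (ln x)) + sqrt (ln (1 / p)))"
      by (rule ennreal_leI)
    also have "\<dots> = ennreal (sqrt (ln x)) + ennreal (sqrt (ln (1 / p)))"
      using l by (subst ennreal_plus) (auto simp: max_def ennreal_neg)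
    finally show ?thesis using False by (simp add: sqrt_log_def)
  qed (simp add: sqrt_log_def)
qed

lemma sqrt_log_ge: "0 \<le> p \<Longrightarrow> p \<le> 1 \<Longrightarrow> 0 < x \<Longrightarrow> ennreal (sqrt (ln x)) \<le> sqrt_log x p"
  by (cases "p = 0") (auto simp: sqrt_log_def intro!: ennreal_leI simp: ln_div)

text \<open>Summability of \<open>1 / v\<close> bounds \<open>v\<close> only from below, and the
  limit hypothesis does not mention \<open>v\<close>. That the contribution of \<open>v\<close> is
  summable is read off from the finiteness of \<open>H n\<close>, since masses are at most 1; what
  remains is controlled by the limit hypothesis.\<close>

lemma H_eventually_small:
  assumes "H n < \<infinity>" "0 < x"
  obtains n' where "H n' \<le> ennreal x"
proof -
  \<comment> \<open>The \<open>max 0\<close> repeats the truncation by \<open>ennreal\<close> at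
    levels with \<open>v m < 1\<close>.\<close>
  define b where "b m = DZ / 2 ^ m * max 0 (sqrt (ln (v m)))" for m
  have b0: "0 \<le> b m" for m using DZ_pos by (simp add: b_def)
  have b_eq: "ennreal (b m) = ennreal (DZ / 2 ^ m) * ennreal (sqrt (ln (v m)))" for m
    using DZ_pos unfolding b_def
    by (subst ennreal_mult) (auto simp: max_def ennreal_neg)
  obtain t where t: "t \<in> T" using T_ne by auto
  have "(\<Sum>j. ennreal (b (j + (n + 1)))) \<le> (\<Sum>j. level_term DZ v (n + 1 + j) t)"
    unfolding b_eq level_term_def add.commute[of _ "n + 1"]
    by (intro suminf_le summableI mult_left_mono sqrt_log_ge mass_le_1 v_pos) auto
  also have "\<dots> < \<infinity>" using level_sum_le_log_tail[OF t] assms(1) by (rule le_less_trans)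
  finally have "summable (\<lambda>j. b (j + (n + 1)))"
    using b0 by (intro summable_suminf_not_top) auto
  then have b: "summable b" by (simp only: summable_iff_shift)
  obtain N1 where N1: "\<And>n. N1 \<le> n \<Longrightarrow> norm (\<Sum>i. b (i + n)) < x / 2"
    using suminf_exist_split[OF _ b, of "x / 2"] assms(2) by auto
  have "eventually (\<lambda>n. log_tail T P \<mu> 1 (\<lambda>_. 1) n < ennreal (x / (2 * DZ))) sequentially"
    using log_tail_lim assms(2) DZ_pos by (intro order_tendstoD) auto
  then obtain N2 where N2: "\<And>n. N2 \<le> n \<Longrightarrow> log_tail T P \<mu> 1 (\<lambda>_. 1) n < ennreal (x / (2 * DZ))"
    by (auto simp: eventually_sequentially)
  let ?n = "max N1 N2"
  have "H ?n \<le> ennreal x"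
    unfolding log_tail_eq
  proof (rule SUP_least)
    fix t assume t: "t \<in> T"
    have "level_term DZ v m t \<le> ennreal (b m) + ennreal DZ * level_term 1 (\<lambda>_. 1) m t" for m
    proof -
      have "level_term DZ v m t
          \<le> ennreal (DZ / 2 ^ m) * (ennreal (sqrt (ln (v m))) + sqrt_log 1 (mass m t))"
        unfolding level_term_def by (intro mult_left_mono sqrt_log_le mass_le_1 v_pos) auto
      also have "\<dots> = ennreal (b m) + ennreal DZ * level_term 1 (\<lambda>_. 1) m t"
        unfolding level_term_def b_eq distrib_left mult.assoc[symmetric]
        using DZ_pos by (subst (3) ennreal_mult[symmetric]) auto
      finally show ?thesis .
    qed
    then have "(\<Sum>j. level_term DZ v (?n + 1 + j) t)
        \<le> (\<Sum>j. ennreal (b (?n + 1 + j)) + ennreal DZ * level_term 1 (\<lambda>_. 1) (?n + 1 + j) t)"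
      by (intro suminf_le summableI)
    also have "\<dots> = (\<Sum>j. ennreal (b (?n + 1 + j))) + ennreal DZ * (\<Sum>j. level_term 1 (\<lambda>_. 1) (?n + 1 + j) t)"
      by (subst suminf_add[symmetric]) (auto intro: summableI simp: ennreal_suminf_cmult)
    also have "\<dots> \<le> ennreal (x / 2) + ennreal DZ * ennreal (x / (2 * DZ))"
    proof (intro add_mono mult_left_mono)
      have "(\<Sum>j. ennreal (b (?n + 1 + j))) = ennreal (\<Sum>j. b (j + (?n + 1)))"
        using b0 summable_ignore_initial_segment[OF b, of "?n + 1"]
        by (subst suminf_ennreal2) (simp_all only: add.commute)
      also have "\<dots> \<le> ennreal (x / 2)"
        using N1[of "?n + 1", OF trans_le_add1[OF max.cobounded1]]
        by (intro ennreal_leI) (simp only: real_norm_def abs_less_iff less_imp_le)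
      finally show "(\<Sum>j. ennreal (b (?n + 1 + j))) \<le> ennreal (x / 2)" .
      show "(\<Sum>j. level_term 1 (\<lambda>_. 1) (?n + 1 + j) t) \<le> ennreal (x / (2 * DZ))"
        using level_sum_le_log_tail[OF t, of 1 "\<lambda>_. 1" ?n] N2[of ?n] by simp
    qed simp
    also have "\<dots> = ennreal x"
      using DZ_pos assms(2) by (simp add: ennreal_mult[symmetric] ennreal_plus[symmetric] del: ennreal_plus)
    finally show "(\<Sum>j. level_term DZ v (?n + 1 + j) t) \<le> ennreal x" .
  qed
  then show ?thesis by (rule that)
qed

lemma v_eventually_gt: "eventually (\<lambda>m. 1 < v m) sequentially"
proof -
  have "eventually (\<lambda>m. 1 / v m < 1) sequentially"
    using summable_LIMSEQ_zero[OF v_sum] by (intro order_tendstoD) auto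
  then show ?thesis by (rule eventually_mono) (use v_pos in \<open>simp add: divide_simps\<close>)
qed

text \<open>Forces high levels for small \<open>\<epsilon>\<close>: as \<open>H\<close> is
  decreasing and positive, \<open>H n \<le> \<epsilon> * \<sigma>\<close> excludes every
  \<open>n\<close> below a given level once \<open>\<epsilon>\<close> is small.\<close>

lemma H_pos: "0 < H n"
proof -
  obtain m where m: "n < m" "1 < v m"
    using eventually_happens'[OF sequentially_bot eventually_conj[OF v_eventually_gt eventually_gt_at_top[of n]]]
    by auto
  obtain t where t: "t \<in> T" using T_ne by auto
  have "0 < ennreal (DZ / 2 ^ m) * ennreal (sqrt (ln (v m)))"
    using m DZ_pos by (simp add: ennreal_zero_less_mult_iff)
  also have "\<dots> \<le> level_term DZ v m t"
    unfolding level_term_def by (intro mult_left_mono sqrt_log_ge mass_le_1 v_pos) auto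
  also have "\<dots> \<le> H n" by (rule level_term_le_log_tail[OF t m(1)])
  finally show ?thesis .
qed

section \<open>The event above level \<open>n\<close>\<close>

text \<open>Formulated on the coordinates above level \<open>n\<close> alone, which makes it
  independent of the partial sums up to \<open>n\<close>. The constraint is imposed per cell and not
  per net point: cells with the same representative may carry different thresholds, and it is the
  masses of the cells that sum to at most 1.\<close>

definition tail_set :: "nat \<Rightarrow> (nat \<times> 'a \<Rightarrow> real) set" where
  "tail_set n = {f \<in> space (PiM (Sigma {n<..} S) (\<lambda>_. borel)).
    \<forall>m>n. \<forall>A\<in>P m. \<bar>f (m, rep m A)\<bar> \<le> sqrt (2 * ln (v m / measure \<mu> A))}"

lemma tail_set_sets: "tail_set n \<in> sets (PiM (Sigma {n<..} S) (\<lambda>_. borel))"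
  unfolding tail_set_def
proof (intro sets.sets_Collect_countable_All)
  fix m
  let ?P = "PiM (Sigma {n<..} S) (\<lambda>_. borel :: real measure)"
  show "{f \<in> space ?P. n < m \<longrightarrow> (\<forall>A\<in>P m. \<bar>f (m, rep m A)\<bar> \<le> sqrt (2 * ln (v m / measure \<mu> A)))} \<in> sets ?P"
  proof (cases "n < m")
    case True
    have "{f \<in> space ?P. \<bar>f (m, rep m A)\<bar> \<le> sqrt (2 * ln (v m / measure \<mu> A))} \<in> sets ?P"
      if "A \<in> P m" for A
    proof -
      have [measurable]: "(\<lambda>f. f (m, rep m A)) \<in> borel_measurable ?P"
        using True rep_in[OF that] by (intro measurable_component_singleton) auto
      show ?thesis by measurable
    qed
    then show ?thesis using True finite_P by (simp add: sets.sets_Collect_finite_All)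
  qed simp
qed

text \<open>At its threshold a cell fails with probability at most
  \<open>2 * (measure \<mu> A / v m)\<close>. Over one level these add up to at most
  \<open>2 / v m\<close>, and over all levels above \<open>n\<close> to at most 1/2.\<close>

lemma tail_set_prob:
  assumes fin: "H n < \<infinity>" and v1: "\<And>m. n < m \<Longrightarrow> 1 \<le> v m"
    and tail: "(\<Sum>j. 1 / v (n + 1 + j)) \<le> 1 / 4"
  shows "1 / 2 \<le> prob {\<omega> \<in> space M. (\<lambda>i\<in>Sigma {n<..} S. g i \<omega>) \<in> tail_set n}"
proof -
  define bad where "bad m = (\<Union>A\<in>P m.
    {\<omega> \<in> space M. sqrt (2 * ln (v m / measure \<mu> A)) < \<bar>g (m, rep m A) \<omega>\<bar>})" for m
  have g_meas: "g (m, rep m A) \<in> borel_measurable M" if "A \<in> P m" for m A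
    using rep_in[OF that] by (intro measurable_X) auto
  have bad_one: "{\<omega> \<in> space M. c < \<bar>g (m, rep m A) \<omega>\<bar>} \<in> sets M" if "A \<in> P m" for m A c
    using g_meas[OF that] by measurable
  have bad_sets: "bad m \<in> sets M" for m
    unfolding bad_def using finite_P bad_one by (intro sets.finite_UN) auto
  have bad_prob: "prob (bad m) \<le> 2 * (1 / v m)" if m: "n < m" for m
  proof -
    have one: "prob {\<omega> \<in> space M. sqrt (2 * ln (v m / measure \<mu> A)) < \<bar>g (m, rep m A) \<omega>\<bar>}
        \<le> 2 * (measure \<mu> A / v m)" if A: "A \<in> P m" for A
    proof -
      obtain t where t: "t \<in> A" using P_nonempty[OF A] by auto
      then have pos: "0 < measure \<mu> A" using mass_pos[OF fin, of t m] cell_eqI[OF A t] P_subset[OF A] by auto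
      have "measure \<mu> A \<le> v m" using v1[OF m] \<mu>.prob_le_1[of A] by linarith
      then have l: "0 \<le> ln (v m / measure \<mu> A)" using pos by simp
      have "prob {\<omega> \<in> space M. sqrt (2 * ln (v m / measure \<mu> A)) < \<bar>g (m, rep m A) \<omega>\<bar>}
          \<le> 2 * exp (- (sqrt (2 * ln (v m / measure \<mu> A)))\<^sup>2 / 2)"
        using rep_in[OF A] l by (intro prob_tail) auto
      also have "\<dots> = 2 * exp (- ln (v m / measure \<mu> A))" using l by simp
      also have "\<dots> = 2 * (measure \<mu> A / v m)"
        using pos v_pos[of m] by (simp add: exp_minus)
      finally show ?thesis .
    qed
    have "prob (bad m) \<le> (\<Sum>A\<in>P m. prob {\<omega> \<in> space M.
        sqrt (2 * ln (v m / measure \<mu> A)) < \<bar>g (m, rep m A) \<omega>\<bar>})"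
      unfolding bad_def using finite_P bad_one by (intro finite_measure_subadditive_finite) auto
    also have "\<dots> \<le> (\<Sum>A\<in>P m. 2 * (measure \<mu> A / v m))" by (intro sum_mono one)
    also have "\<dots> = 2 * ((\<Sum>A\<in>P m. measure \<mu> A) / v m)"
      by (simp add: sum_distrib_left sum_divide_distrib)
    also have "\<dots> \<le> 2 * (1 / v m)"
      using sum_mass v_pos[of m] by (intro mult_left_mono divide_right_mono) auto
    finally show ?thesis .
  qed
  have v_sum': "summable (\<lambda>j. 2 * (1 / v (n + 1 + j)))"
    using summable_ignore_initial_segment[OF v_sum, of "n + 1"]
    by (intro summable_mult) (simp only: add.commute)
  have sum_bad: "summable (\<lambda>j. prob (bad (n + 1 + j)))"
    using bad_prob by (intro summable_comparison_test'[OF v_sum', of 0]) auto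
  have "prob (\<Union>j. bad (n + 1 + j)) \<le> (\<Sum>j. prob (bad (n + 1 + j)))"
    using bad_sets by (intro finite_measure_subadditive_countably sum_bad) auto
  also have "\<dots> \<le> (\<Sum>j. 2 * (1 / v (n + 1 + j)))"
    using bad_prob by (intro suminf_le sum_bad v_sum') auto
  also have "\<dots> = 2 * (\<Sum>j. 1 / v (n + 1 + j))"
    using summable_ignore_initial_segment[OF v_sum, of "n + 1"]
    by (intro suminf_mult) (simp only: add.commute)
  also have "\<dots> \<le> 1 / 2" using tail by simp
  finally have "prob (\<Union>j. bad (n + 1 + j)) \<le> 1 / 2" .
  moreover have "prob (space M - (\<Union>j. bad (n + 1 + j))) = 1 - prob (\<Union>j. bad (n + 1 + j))"
    using bad_sets by (intro prob_compl) auto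
  moreover have "space M - (\<Union>j. bad (n + 1 + j))
      \<subseteq> {\<omega> \<in> space M. (\<lambda>i\<in>Sigma {n<..} S. g i \<omega>) \<in> tail_set n}"
  proof
    fix \<omega> assume \<omega>: "\<omega> \<in> space M - (\<Union>j. bad (n + 1 + j))"
    have "\<bar>g (m, rep m A) \<omega>\<bar> \<le> sqrt (2 * ln (v m / measure \<mu> A))" if "n < m" "A \<in> P m" for m A
    proof -
      have "\<omega> \<notin> bad (n + 1 + (m - n - 1))" using \<omega> by blast
      then have "\<omega> \<notin> bad m" using that by simp
      then show ?thesis using that(2) \<omega> by (force simp: bad_def)
    qed
    then show "\<omega> \<in> {\<omega> \<in> space M. (\<lambda>i\<in>Sigma {n<..} S. g i \<omega>) \<in> tail_set n}"
      using \<omega> rep_in by (auto simp: tail_set_def space_PiM)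
  qed
  then have "prob (space M - (\<Union>j. bad (n + 1 + j)))
      \<le> prob {\<omega> \<in> space M. (\<lambda>i\<in>Sigma {n<..} S. g i \<omega>) \<in> tail_set n}"
    using measurable_sets[OF measurable_restrict_X tail_set_sets, of n]
    by (intro finite_measure_mono) (auto simp: vimage_def Int_def conj_commute)
  ultimately show ?thesis by linarith
qed

text \<open>On the tail event each point has a deterministic majorant built from its own cells; this
  gives convergence at every point at once, with no exceptional null sets.\<close>

lemma Z_bound_on_tail_set:
  assumes t: "t \<in> T" and tail: "(\<lambda>i\<in>Sigma {n<..} S. g i \<omega>) \<in> tail_set n"
    and fin: "H n \<le> ennreal x" and x: "0 \<le> x" and v1: "\<And>m. n < m \<Longrightarrow> 1 \<le> v m"
    and centers: "\<bar>\<Sum>j\<le>n. rad j * g (j, ctr j t) \<omega>\<bar> \<le> x / 4"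
  shows "summable (Z_term T d g (limit_embed T d S t) \<omega>)"
    and "\<bar>Z T d g (limit_embed T d S t) \<omega>\<bar> \<le> 2 * x"
proof -
  let ?z = "Z_term T d g (limit_embed T d S t) \<omega>"
  have fin': "H n < \<infinity>" using fin by (auto intro: le_less_trans)
  define b where "b m = DZ / 2 ^ m * sqrt (ln (v m / mass m t))" for m
  have l: "0 \<le> ln (v m / mass m t)" if "n < m" for m
    using order_trans[OF mass_le_1[of m t] v1[OF that]] mass_pos[OF fin' t, of m] by simp
  have b0: "0 \<le> b m" if "n < m" for m using l[OF that] DZ_pos by (simp add: b_def)
  have b_eq: "level_term DZ v m t = ennreal (b m)" if "n < m" for m
    using mass_pos[OF fin' t, of m] l[OF that] DZ_pos
    by (simp add: level_term_def sqrt_log_def b_def flip: ennreal_mult)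
  have "(\<Sum>j. ennreal (b (n + 1 + j))) = (\<Sum>j. level_term DZ v (n + 1 + j) t)"
    by (simp add: b_eq)
  also have "\<dots> \<le> ennreal x" using level_sum_le_log_tail[OF t] fin by (rule order_trans)
  finally have le: "(\<Sum>j. ennreal (b (n + 1 + j))) \<le> ennreal x" .
  have sum_b: "summable (\<lambda>j. b (n + 1 + j))"
    using b0 le by (intro summable_suminf_not_top) (auto simp: top_unique)
  have b_le: "(\<Sum>j. b (n + 1 + j)) \<le> x"
    using le b0 x sum_b by (subst (asm) suminf_ennreal2) auto
  have z_le: "norm (?z m) \<le> 7 / 4 * b m" if m: "n < m" for m
  proof -
    have cell: "rep m (cell (P m) t) = ctr m t" using rep_eq[OF cell_in[OF t] mem_cell[OF t]] .
    have "\<bar>g (m, ctr m t) \<omega>\<bar> \<le> sqrt (2 * ln (v m / mass m t))"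
      using tail m cell_in[OF t, of m] center_in[OF t, of m] unfolding tail_set_def
      by (auto dest!: spec[of _ m] bspec[of _ _ "cell (P m) t"] simp: cell)
    then have "norm (?z m) \<le> rad m * (sqrt 2 * sqrt (ln (v m / mass m t)))"
      using rad_nonneg[of m] by (simp add: Z_term_embed abs_mult mult_left_mono real_sqrt_mult)
    also have "\<dots> \<le> rad m * (7 / 4 * (sqrt (8 / 3) / 2) * sqrt (ln (v m / mass m t)))"
    proof (intro mult_left_mono mult_right_mono rad_nonneg)
      \<comment> \<open>\<open>DZ / 2 ^ m\<close> is \<open>sqrt (8 / 3) / 2 * rad m\<close>, so the
        ratio in question is sqrt 3. The rational bound 7/4 leaves \<open>x / 4\<close> for the
        partial sum.\<close>
      have "sqrt 2 \<le> sqrt ((7 / 8)\<^sup>2 * (8 / 3))"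
        by (intro real_sqrt_le_mono) (simp add: power2_eq_square)
      also have "\<dots> = 7 / 8 * sqrt (8 / 3)" by (subst real_sqrt_mult) simp
      finally show "sqrt 2 \<le> 7 / 4 * (sqrt (8 / 3) / 2)" by linarith
    qed (use l[OF m] in auto)
    also have "\<dots> = 7 / 4 * b m" by (simp add: b_def DZ_eq radius_def mult_ac)
    finally show ?thesis .
  qed
  have shift_le: "norm (?z (j + (n + 1))) \<le> 7 / 4 * b (n + 1 + j)" for j
    using z_le[of "j + (n + 1)"] by (simp add: add_ac)
  have "summable (\<lambda>j. ?z (j + (n + 1)))"
    by (rule summable_comparison_test'[OF summable_mult[OF sum_b] shift_le])
  then show sum_z: "summable ?z" by (simp only: summable_iff_shift)
  have "\<bar>\<Sum>j. ?z (j + (n + 1))\<bar> \<le> (\<Sum>j. 7 / 4 * b (n + 1 + j))"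
    using norm_suminf_le[OF shift_le summable_mult[OF sum_b]] by simp
  also have "\<dots> \<le> 7 / 4 * x" using suminf_mult[OF sum_b, of "7 / 4"] b_le by simp
  finally have "\<bar>\<Sum>j. ?z (j + (n + 1))\<bar> \<le> 7 / 4 * x" .
  moreover have "suminf ?z = (\<Sum>j. ?z (j + (n + 1))) + (\<Sum>j<n + 1. ?z j)"
    by (rule suminf_split_initial_segment[OF sum_z])
  moreover have "(\<Sum>j<n + 1. ?z j) = (\<Sum>j\<le>n. rad j * g (j, ctr j t) \<omega>)"
    by (simp add: Z_term_embed lessThan_Suc_atMost)
  ultimately show "\<bar>Z T d g (limit_embed T d S t) \<omega>\<bar> \<le> 2 * x"
    using centers unfolding Z_def by linarith
qed

text \<open>Levels up to \<open>n\<close> and levels above it are disjoint blocks of variables, so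
  the two probabilities multiply. Their joint event is measurable and contained in
  \<open>small_sup\<close>, as the inner measure requires; below, the points of \<open>T\<close>
  only matter through their centers in \<open>S n\<close>.\<close>

lemma small_sup_at_level:
  assumes fin: "H n \<le> ennreal x" and x: "0 \<le> x"
    and v1: "\<And>m. n < m \<Longrightarrow> 1 \<le> v m" and tail: "(\<Sum>j. 1 / v (n + 1 + j)) \<le> 1 / 4"
    and p: "p \<le> prob {\<omega> \<in> space M. \<forall>u\<in>S n. \<bar>\<Sum>j\<le>n. rad j * g (j, ctr j u) \<omega>\<bar> \<le> x / 4}"
  shows "ennreal (p / 2) \<le> inner_measure_of M (small_sup T d M g (limit_embed T d S ` T) (2 * x))"
proof -
  let ?I = "Sigma {..n} S" and ?J = "Sigma {n<..} S"
  let ?P = "PiM ?I (\<lambda>_. borel :: real measure)"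
  define E where "E = {f \<in> space ?P. \<forall>u\<in>S n. \<bar>\<Sum>j\<le>n. rad j * f (j, ctr j u)\<bar> \<le> x / 4}"
  have in_I: "(j, ctr j u) \<in> ?I" if "j \<le> n" "u \<in> S n" for j u
    using that center_in net_subset by auto
  have E_sets: "E \<in> sets ?P"
    unfolding E_def
  proof (intro sets.sets_Collect_finite_All finite_net)
    fix u assume u: "u \<in> S n"
    have [measurable]: "(\<lambda>f. \<Sum>j\<le>n. rad j * f (j, ctr j u)) \<in> borel_measurable ?P"
      using in_I[OF _ u] by (intro borel_measurable_sum borel_measurable_times borel_measurable_const
          measurable_component_singleton) auto
    show "{f \<in> space ?P. \<bar>\<Sum>j\<le>n. rad j * f (j, ctr j u)\<bar> \<le> x / 4} \<in> sets ?P" by measurable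
  qed
  have in_E: "(\<lambda>i\<in>?I. g i \<omega>) \<in> E \<longleftrightarrow> (\<forall>u\<in>S n. \<bar>\<Sum>j\<le>n. rad j * g (j, ctr j u) \<omega>\<bar> \<le> x / 4)" for \<omega>
  proof -
    have "(\<Sum>j\<le>n. rad j * (\<lambda>i\<in>?I. g i \<omega>) (j, ctr j u)) = (\<Sum>j\<le>n. rad j * g (j, ctr j u) \<omega>)"
      if "u \<in> S n" for u
      using in_I[OF _ that] by (intro sum.cong) auto
    then show ?thesis by (auto simp: E_def space_PiM)
  qed
  let ?B = "{\<omega> \<in> space M. (\<lambda>i\<in>?I. g i \<omega>) \<in> E \<and> (\<lambda>i\<in>?J. g i \<omega>) \<in> tail_set n}"
  have B_sets: "?B \<in> sets M"
  proof -
    have [measurable]: "(\<lambda>\<omega>. \<lambda>i\<in>?I. g i \<omega>) \<in> M \<rightarrow>\<^sub>M ?P"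
      "(\<lambda>\<omega>. \<lambda>i\<in>?J. g i \<omega>) \<in> M \<rightarrow>\<^sub>M PiM ?J (\<lambda>_. borel)"
      by (auto intro!: measurable_restrict_X)
    note [measurable] = E_sets tail_set_sets
    show ?thesis by measurable
  qed
  have fin': "H n < \<infinity>" using fin by (auto intro: le_less_trans)
  have "prob ?B = prob {\<omega> \<in> space M. (\<lambda>i\<in>?I. g i \<omega>) \<in> E}
      * prob {\<omega> \<in> space M. (\<lambda>i\<in>?J. g i \<omega>) \<in> tail_set n}"
    by (rule prob_blocks[OF _ _ _ E_sets tail_set_sets]) auto
  also have "\<dots> \<ge> prob {\<omega> \<in> space M. (\<lambda>i\<in>?I. g i \<omega>) \<in> E} * (1 / 2)"
    by (intro mult_left_mono tail_set_prob fin' v1 tail) auto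
  finally have "p / 2 \<le> prob ?B" using p unfolding in_E by simp
  then have "ennreal (p / 2) \<le> emeasure M ?B"
    by (simp add: emeasure_eq_measure ennreal_leI)
  also have "\<dots> \<le> inner_measure_of M (small_sup T d M g (limit_embed T d S ` T) (2 * x))"
    unfolding inner_measure_of_def
  proof (rule SUP_upper, safe)
    fix \<omega> assume \<omega>: "\<omega> \<in> space M" "(\<lambda>i\<in>?I. g i \<omega>) \<in> E" "(\<lambda>i\<in>?J. g i \<omega>) \<in> tail_set n"
    have "\<bar>\<Sum>j\<le>n. rad j * g (j, ctr j t) \<omega>\<bar> \<le> x / 4" if t: "t \<in> T" for t
    proof -
      have "(\<Sum>j\<le>n. rad j * g (j, ctr j t) \<omega>) = (\<Sum>j\<le>n. rad j * g (j, ctr j (ctr n t)) \<omega>)"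
        using t by (intro sum.cong) (auto simp: center_center)
      then show ?thesis using \<omega>(2) center_in[OF t, of n] unfolding in_E by simp
    qed
    note Z = Z_bound_on_tail_set[OF _ \<omega>(3) fin x v1 this]
    then show "\<omega> \<in> small_sup T d M g (limit_embed T d S ` T) (2 * x)"
      using \<omega>(1) by (auto simp: small_sup_def intro!: SUP_least)
  qed (rule B_sets)
  finally show ?thesis .
qed

lemma inner_measure_small_sup_mono:
  assumes "x \<le> y"
  shows "inner_measure_of M (small_sup T d M g A x) \<le> inner_measure_of M (small_sup T d M g A y)"
proof -
  have sub: "small_sup T d M g A x \<subseteq> small_sup T d M g A y"
  proof
    fix \<omega> assume \<omega>: "\<omega> \<in> small_sup T d M g A x"
    then have "(SUP x\<in>A. ereal \<bar>Z T d g x \<omega>\<bar>) \<le> ereal x" by (simp add: small_sup_def)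
    also have "ereal x \<le> ereal y" using assms by simp
    finally show "\<omega> \<in> small_sup T d M g A y" using \<omega> by (simp add: small_sup_def)
  qed
  show ?thesis
    unfolding inner_measure_of_def
  proof (rule SUP_subset_mono)
    show "{B \<in> sets M. B \<subseteq> small_sup T d M g A x} \<subseteq> {B \<in> sets M. B \<subseteq> small_sup T d M g A y}"
      using order_trans[OF _ sub] by (intro Collect_mono) simp
  qed simp
qed

lemma small_sup_lower_bound:
  fixes \<sigma> :: real
  assumes \<sigma>_def: "\<sigma> = 2 * diam T d / sqrt 3"
  shows "\<exists>C>0. \<forall>\<epsilon> n. 0 < \<epsilon> * \<sigma> \<and> ennreal (\<epsilon> * \<sigma>) < H 0 \<and> admissible_level H \<sigma> \<epsilon> n \<longrightarrow>
    ennreal (C * exp (- (real (card (P n)) * ln (1 / \<epsilon>))))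
      \<le> inner_measure_of M (small_sup T d M g (limit_embed T d S ` T) (2 * \<epsilon> * \<sigma>))"
proof (cases "\<exists>n. H n < \<infinity>")
  case False
  \<comment> \<open>If every \<open>H n\<close> is infinite, no level is admissible and any constant
    will do.\<close>
  then have "\<not> admissible_level H \<sigma> \<epsilon> n" for \<epsilon> n
    by (auto simp: admissible_level_def top_unique not_less)
  then show ?thesis by (intro exI[of _ 1]) auto
next
  case True
  then obtain N where N: "H N < \<infinity>" by blast
  have \<sigma>: "0 < \<sigma>" using diam_pos by (simp add: \<sigma>_def)
  let ?in = "\<lambda>\<epsilon>. inner_measure_of M (small_sup T d M g (limit_embed T d S ` T) (2 * \<epsilon> * \<sigma>))"
  have exp_eq: "exp (- (real k * ln (1 / \<epsilon>))) = \<epsilon> ^ k" if "0 < \<epsilon>" for \<epsilon> :: real and k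
    using that by (simp add: ln_div exp_of_nat_mult)
  obtain r k where r: "0 < r" and ball: "\<And>n \<epsilon>. k \<le> n \<Longrightarrow> 0 < \<epsilon> \<Longrightarrow> \<epsilon> \<le> 1 / 16 \<Longrightarrow>
      r * \<epsilon> ^ card (S n) \<le> prob {\<omega> \<in> space M. \<forall>u\<in>S n.
        \<bar>\<Sum>j\<le>n. rad j * g (j, ctr j u) \<omega>\<bar> \<le> \<epsilon> * \<sigma> / 4}"
    using center_small_ball[OF T_ne] unfolding \<sigma>_def by blast
  obtain K1 where K1: "\<And>m. K1 \<le> m \<Longrightarrow> 1 < v m"
    using v_eventually_gt by (auto simp: eventually_sequentially)
  obtain K2 where K2: "\<And>n. K2 \<le> n \<Longrightarrow> norm (\<Sum>i. 1 / v (i + n)) < 1 / 4"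
    using suminf_exist_split[OF _ v_sum, of "1 / 4"] by auto
  \<comment> \<open>From \<open>n0\<close> on the small ball estimate applies, \<open>v\<close>
    exceeds 1 and the tails of its reciprocals are below 1/4.\<close>
  define n0 where "n0 = max k (max K1 K2)"
  \<comment> \<open>Levels below \<open>n0\<close> have \<open>H\<close> at least
    \<open>H n0\<close>, hence above \<open>x0\<close>; so for
    \<open>\<epsilon> \<le> \<epsilon>0\<close> only levels from \<open>n0\<close> on can
    occur.\<close>
  obtain x0 where x0: "0 < x0" "ennreal x0 < H n0"
  proof -
    obtain y where "0 < y" "y < H n0" using dense[OF H_pos] by blast
    then show ?thesis
      using that[of "enn2real y"] by (metis enn2real_positive_iff ennreal_enn2real_if less_top
          order_less_trans top_greatest not_less)
  qed
  define \<epsilon>0 where "\<epsilon>0 = min (1 / 16) (x0 / \<sigma>)"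
  have \<epsilon>0: "0 < \<epsilon>0" "\<epsilon>0 \<le> 1 / 16" "\<epsilon>0 * \<sigma> \<le> x0"
    using x0 \<sigma> by (auto simp: \<epsilon>0_def min_def field_simps)
  have small: "ennreal (r * \<epsilon> ^ card (S n) / 2) \<le> ?in \<epsilon>"
    if \<epsilon>: "0 < \<epsilon>" "\<epsilon> \<le> \<epsilon>0" and n: "H n \<le> ennreal (\<epsilon> * \<sigma>)" for \<epsilon> n
  proof -
    have "n0 \<le> n"
    proof (rule ccontr)
      assume "\<not> n0 \<le> n"
      then have "H n0 \<le> H n" by (intro log_tail_antimono) simp
      also have "\<dots> \<le> ennreal (\<epsilon> * \<sigma>)" by (rule n)
      also have "\<dots> \<le> ennreal x0"
        using \<epsilon> \<epsilon>0 \<sigma> by (intro ennreal_leI) (meson less_imp_le mult_right_mono order_trans)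
      finally show False using x0 by simp
    qed
    then have n: "k \<le> n" "K1 \<le> n" "K2 \<le> n" "H n \<le> ennreal (\<epsilon> * \<sigma>)"
      using n by (auto simp: n0_def)
    have "ennreal (r * \<epsilon> ^ card (S n) / 2)
        \<le> inner_measure_of M (small_sup T d M g (limit_embed T d S ` T) (2 * (\<epsilon> * \<sigma>)))"
    proof (rule small_sup_at_level[OF n(4)])
      show "1 \<le> v m" if "n < m" for m using K1[of m] n that by simp
      show "(\<Sum>j. 1 / v (n + 1 + j)) \<le> 1 / 4"
        using K2[of "n + 1"] n by (simp add: add_ac abs_less_iff)
      show "r * \<epsilon> ^ card (S n) \<le> prob {\<omega> \<in> space M. \<forall>u\<in>S n.
          \<bar>\<Sum>j\<le>n. rad j * g (j, ctr j u) \<omega>\<bar> \<le> \<epsilon> * \<sigma> / 4}"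
        using \<epsilon> \<epsilon>0 by (intro ball n(1)) auto
    qed (use \<epsilon> \<sigma> in auto)
    then show ?thesis by (simp add: mult.assoc)
  qed
  \<comment> \<open>One fixed level for the reference value \<open>\<epsilon>0\<close>; every larger
    \<open>\<epsilon>\<close> inherits its probability by monotonicity.\<close>
  obtain n1 where n1: "H n1 \<le> ennreal (\<epsilon>0 * \<sigma>)"
    using H_eventually_small[OF N, of "\<epsilon>0 * \<sigma>"] \<epsilon>0 \<sigma> by auto
  define p where "p = r * \<epsilon>0 ^ card (S n1) / 2"
  \<comment> \<open>For \<open>\<epsilon> > 1\<close> the power grows with the number of cells.
    Leastness of \<open>n\<close> gives \<open>n \<le> n1\<close>, and
    \<open>\<epsilon> * \<sigma> < H 0\<close> bounds the base; \<open>K\<close> combines the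
    two.\<close>
  define N1 where "N1 = Max ((\<lambda>n. card (P n)) ` {..n1})"
  define K where "K = max 1 (enn2real (H 0) / \<sigma>) ^ N1"
  have p: "0 < p" "ennreal p \<le> ?in \<epsilon>0"
    using small[OF \<epsilon>0(1) order_refl n1] r \<epsilon>0 by (auto simp: p_def)
  have K: "1 \<le> K" by (simp add: K_def one_le_power)
  define C where "C = min (r / 2) (p / K)"
  have C: "0 < C" "C \<le> r / 2" "C * K \<le> p"
  proof -
    show "C \<le> r / 2" unfolding C_def by (rule min.cobounded1)
    show "0 < C" using r p K by (simp add: C_def)
    have "C \<le> p / K" by (simp add: C_def)
    then show "C * K \<le> p" using K by (simp add: pos_le_divide_eq)
  qed
  have "ennreal (C * exp (- (real (card (P n)) * ln (1 / \<epsilon>)))) \<le> ?in \<epsilon>"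
    if pos: "0 < \<epsilon> * \<sigma>" and lt: "ennreal (\<epsilon> * \<sigma>) < H 0" and adm: "admissible_level H \<sigma> \<epsilon> n" for \<epsilon> n
  proof -
    have \<epsilon>: "0 < \<epsilon>" using pos \<sigma> by (simp add: zero_less_mult_iff)
    have Hn: "H n \<le> ennreal (\<epsilon> * \<sigma>)" using adm by (simp add: admissible_level_def)
    show ?thesis
    proof (cases "\<epsilon> \<le> \<epsilon>0")
      case True
      have "C * \<epsilon> ^ card (P n) \<le> r / 2 * \<epsilon> ^ card (S n)"
        using C True \<epsilon> \<epsilon>0 r by (intro mult_mono power_decreasing card_net_le_card_P) auto
      then have "ennreal (C * \<epsilon> ^ card (P n)) \<le> ennreal (r * \<epsilon> ^ card (S n) / 2)"
        by (intro ennreal_leI) simp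
      also have "\<dots> \<le> ?in \<epsilon>" by (rule small[OF \<epsilon> True Hn])
      finally show ?thesis by (simp only: exp_eq[OF \<epsilon>])
    next
      case False
      have "\<epsilon> ^ card (P n) \<le> K"
      proof (cases "\<epsilon> \<le> 1")
        case True
        then have "\<epsilon> ^ card (P n) \<le> 1" using \<epsilon> by (intro power_le_one) auto
        then show ?thesis using K by linarith
      next
        case gt: False
        have "n \<le> n1"
        proof (rule ccontr)
          assume "\<not> n \<le> n1"
          then have "ennreal (\<epsilon> * \<sigma>) < H n1" using adm gt by (auto simp: admissible_level_def)
          also note n1
          finally show False using False \<sigma> \<epsilon>0 by (simp add: ennreal_less_iff)
        qed
        then have card: "card (P n) \<le> N1" unfolding N1_def by (intro Max_ge) auto
        have "\<epsilon> * \<sigma> \<le> enn2real (H 0)"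
          using lt H_0_finite[OF N] pos by (cases "H 0") (auto simp: ennreal_less_iff)
        then have "\<epsilon> \<le> max 1 (enn2real (H 0) / \<sigma>)" using \<sigma> by (auto simp: le_max_iff_disj field_simps)
        then have "\<epsilon> ^ card (P n) \<le> max 1 (enn2real (H 0) / \<sigma>) ^ card (P n)"
          using \<epsilon> by (intro power_mono) auto
        also have "\<dots> \<le> K" unfolding K_def by (intro power_increasing card) auto
        finally show ?thesis .
      qed
      then have "C * \<epsilon> ^ card (P n) \<le> C * K" using C by (intro mult_left_mono) auto
      also note C(3)
      finally have "ennreal (C * \<epsilon> ^ card (P n)) \<le> ennreal p" by (rule ennreal_leI)
      also note p(2)
      also have "?in \<epsilon>0 \<le> ?in \<epsilon>"
        using False \<sigma> by (intro inner_measure_small_sup_mono) simp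
      finally show ?thesis by (simp only: exp_eq[OF \<epsilon>])
    qed
  qed
  then show ?thesis using C(1) by blast
qed

end

theorem theorem5p2:
  shows
    "(\<exists>\<gamma>>0. \<forall>(T :: 'a set) d S (M :: 'b measure) g.
        ultrametric_gaussian T d S M g \<longrightarrow>
        (\<forall>\<epsilon>. 0 < \<epsilon> \<and> \<epsilon> \<le> diam T d \<longrightarrow>
          outer_measure_of M (small_oscillation T d M g (proj_limit T d S) \<epsilon>)
            \<le> ennreal (exp (- \<gamma> * real (entropy_number T d (2 * \<epsilon>))))))
     \<and>
     (\<forall>(T :: 'a set) d S (M :: 'b measure) g P \<mu> v dZ DZ H \<sigma>.
        ultrametric_gaussian T d S M g \<longrightarrow>
        dZ = Z_dist T d S M g \<longrightarrow>
        DZ = diam T dZ \<longrightarrow>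
        admissible_partitions T d dZ P \<longrightarrow>
        prob_space \<mu> \<longrightarrow> space \<mu> = T \<longrightarrow> sets \<mu> = borel_sets_on T d \<longrightarrow>
        (log_tail T P \<mu> 1 (\<lambda>_. 1) \<longlonglongrightarrow> 0) \<longrightarrow>
        (\<forall>m. v m > 0) \<longrightarrow> summable (\<lambda>m. 1 / v m) \<longrightarrow>
        H = log_tail T P \<mu> DZ v \<longrightarrow>
        \<sigma> = 2 * diam T d / sqrt 3 \<longrightarrow>
        (\<exists>C>0. \<forall>\<epsilon> n.
           0 < \<epsilon> * \<sigma> \<and> ennreal (\<epsilon> * \<sigma>) < H 0 \<and> admissible_level H \<sigma> \<epsilon> n \<longrightarrow>
           ennreal (C * exp (- (real (card (P n)) * ln (1 / \<epsilon>))))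
             \<le> inner_measure_of M (small_sup T d M g (limit_embed T d S ` T) (2 * \<epsilon> * \<sigma>))))"
proof (intro conjI allI impI, goal_cases)
  case 1
  show ?case by (rule small_oscillation_bound)
next
  case (2 T d S M g P \<mu> v dZ DZ H \<sigma>)
  interpret majorized_process T d S M g \<mu> P v
    using 2 ultrametric_processI[of T d S M g]
    by (simp add: majorized_process_def majorized_process_axioms_def)
  show ?case
    using small_sup_lower_bound[OF \<open>\<sigma> = _\<close>] 2 by simp
qed

end
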